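(* The greedy algorithm for the Maximum Matrix Contraction problem can be implemented to run in time $O(p^2\cdot q^2)$ on a $p\times q$ binary input matrix.
   Context: A binary matrix has entries in $\{0,1\}$. For a binary matrix, contracting line $i$ with line $i+1$ means replacing line $i$ by the sum of lines $i$ and $i+1$ and deleting line $i+1$; contracting column $j$ with column $j+1$ is defined analogously. A contraction is valid if the resulting matrix is still binary. The density of a binary matrix is the number of unordered pairs of $1$-entries at positions $(i,j),(i',j')$ with $\max(|i-i'|,|j-j'|)=1$. The Maximum Matrix Contraction problem asks for a set of lines and columns of a given $p\times q$ binary matrix $M$ whose joint contraction is valid and maximizes the density of the result. The greedy algorithm: repeatedly, for the current matrix, compute for every line $i$ and every column $j$ whose single contraction (with line $i+1$, resp. column $j+1$) is valid the density of the resulting matrix, and perform a contraction achieving the maximum such density; stop when no single line or column contraction is valid any more, and return the set of contracted lines and columns. *)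

theory Defs
  imports "Jordan_Normal_Form.Matrix"
begin

definition binary :: "nat mat \<Rightarrow> bool" where
  "binary A \<longleftrightarrow> elements_mat A \<subseteq> {0, 1}"

datatype contraction = Line nat | Column nat

fun contract :: "contraction \<Rightarrow> nat mat \<Rightarrow> nat mat" where
  "contract (Line i) A = mat (dim_row A - 1) (dim_col A)
     (\<lambda>(r, c). if r < i then A $$ (r, c)
               else if r = i then A $$ (i, c) + A $$ (i + 1, c)
               else A $$ (r + 1, c))"
| "contract (Column j) A = mat (dim_row A) (dim_col A - 1)
     (\<lambda>(r, c). if c < j then A $$ (r, c)
               else if c = j then A $$ (r, j) + A $$ (r, j + 1)
               else A $$ (r, c + 1))"

fun applicable :: "contraction \<Rightarrow> nat mat \<Rightarrow> bool" where
  "applicable (Line i) A \<longleftrightarrow> i + 1 < dim_row A"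
| "applicable (Column j) A \<longleftrightarrow> j + 1 < dim_col A"

definition valid :: "contraction \<Rightarrow> nat mat \<Rightarrow> bool" where
  "valid x A \<longleftrightarrow> applicable x A \<and> binary (contract x A)"

definition one_positions :: "nat mat \<Rightarrow> (nat \<times> nat) set" where
  "one_positions A = {(i, j). i < dim_row A \<and> j < dim_col A \<and> A $$ (i, j) = 1}"

definition density :: "nat mat \<Rightarrow> nat" where
  "density A = card {{(i, j), (i', j')} | i j i' j'.
     (i, j) \<in> one_positions A \<and> (i', j') \<in> one_positions A \<and>
     max \<bar>int i - int i'\<bar> \<bar>int j - int j'\<bar> = 1}"

definition greedy_choice :: "nat mat \<Rightarrow> contraction \<Rightarrow> bool" where
  "greedy_choice A x \<longleftrightarrow> valid x A \<and>
     (\<forall>y. valid y A \<longrightarrow> density (contract y A) \<le> density (contract x A))"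

text \<open>
  A set \<open>L\<close> of line indices of the input stands for contracting every line \<open>l \<in> L\<close> with the
  line \<open>l + 1\<close>. The lines of the contracted matrix then are the maximal blocks
  \<open>k, k + 1, \<dots>, l\<close> with \<open>k, \<dots>, l - 1 \<in> L\<close> and \<open>l \<notin> L\<close>, and \<open>current_index L r\<close> is the index of
  the block containing the input line \<open>r\<close>. Columns are treated in the same way.
\<close>

definition current_index :: "nat set \<Rightarrow> nat \<Rightarrow> nat" where
  "current_index L r = card ({..<r} - L)"

text \<open>
  \<open>greedy_reaches M A L C\<close>: some run of the greedy algorithm on \<open>M\<close>, with ties broken
  arbitrarily, arrives at the current matrix \<open>A\<close> having contracted the input lines \<open>L\<close> and the
  input columns \<open>C\<close>. Contracting the current line \<open>i\<close> with its successor amounts to adding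
  to \<open>L\<close> the last input line \<open>l\<close> of the block \<open>i\<close>, i.e. the only \<open>l \<notin> L\<close> with
  \<open>current_index L l = i\<close>.
\<close>

inductive greedy_reaches :: "nat mat \<Rightarrow> nat mat \<Rightarrow> nat set \<Rightarrow> nat set \<Rightarrow> bool" for M where
  start: "greedy_reaches M M {} {}"
| line: "\<lbrakk>greedy_reaches M A L C; l < dim_row M; l \<notin> L;
          greedy_choice A (Line (current_index L l))\<rbrakk>
         \<Longrightarrow> greedy_reaches M (contract (Line (current_index L l)) A) (insert l L) C"
| column: "\<lbrakk>greedy_reaches M A L C; c < dim_col M; c \<notin> C;
            greedy_choice A (Column (current_index C c))\<rbrakk>
           \<Longrightarrow> greedy_reaches M (contract (Column (current_index C c)) A) L (insert c C)"

definition greedy_returns :: "nat mat \<Rightarrow> nat set \<Rightarrow> nat set \<Rightarrow> bool" where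
  "greedy_returns M L C \<longleftrightarrow> (\<exists>A. greedy_reaches M A L C \<and> (\<nexists>x. valid x A))"

text \<open>
  The matrix reached by the greedy algorithm is the joint contraction of the recorded lines and
  columns, so the bookkeeping above records the right indices.
\<close>

definition joint_contraction :: "nat mat \<Rightarrow> nat set \<Rightarrow> nat set \<Rightarrow> nat mat" where
  "joint_contraction M L C = mat (card ({..<dim_row M} - L)) (card ({..<dim_col M} - C))
     (\<lambda>(a, b). \<Sum>r | r < dim_row M \<and> current_index L r = a.
                \<Sum>c | c < dim_col M \<and> current_index C c = b. M $$ (r, c))"

lemma current_index_mono: "r \<le> s \<Longrightarrow> current_index L r \<le> current_index L s"
  unfolding current_index_def by (intro card_mono) auto

lemma current_index_less: "l < r \<Longrightarrow> l \<notin> L \<Longrightarrow> current_index L l < current_index L r"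
  unfolding current_index_def by (intro psubset_card_mono) auto

lemma current_index_insert:
  assumes "l \<notin> L"
  shows "current_index (insert l L) r =
    (if current_index L r \<le> current_index L l then current_index L r else current_index L r - 1)"
proof (cases "r \<le> l")
  case True
  then have "{..<r} - insert l L = {..<r} - L" by auto
  with True show ?thesis
    using current_index_mono[OF True, of L] by (simp add: current_index_def)
next
  case False
  then have "{..<r} - insert l L = ({..<r} - L) - {l}" "l \<in> {..<r} - L" using assms by auto
  with False assms current_index_less[of l r L] show ?thesis
    by (simp add: current_index_def)
qed

lemma block_insert:
  assumes "l \<notin> L"
  shows "{r. r < n \<and> current_index (insert l L) r = a} =
    (if a < current_index L l then {r. r < n \<and> current_index L r = a}
     else if a = current_index L l
     then {r. r < n \<and> current_index L r = a} \<union> {r. r < n \<and> current_index L r = a + 1}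
     else {r. r < n \<and> current_index L r = a + 1})"
  using assms by (auto simp: current_index_insert split: if_splits)

lemma sum_block_insert:
  fixes f :: "nat \<Rightarrow> nat"
  assumes "l \<notin> L"
  shows "(\<Sum>r | r < n \<and> current_index (insert l L) r = a. f r) =
    (if a < current_index L l then \<Sum>r | r < n \<and> current_index L r = a. f r
     else if a = current_index L l
     then (\<Sum>r | r < n \<and> current_index L r = a. f r) + (\<Sum>r | r < n \<and> current_index L r = a + 1. f r)
     else \<Sum>r | r < n \<and> current_index L r = a + 1. f r)"
proof -
  have "(\<Sum>r \<in> {r. r < n \<and> current_index L r = a} \<union> {r. r < n \<and> current_index L r = a + 1}. f r)
    = (\<Sum>r | r < n \<and> current_index L r = a. f r) + (\<Sum>r | r < n \<and> current_index L r = a + 1. f r)"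
    by (rule sum.union_disjoint) auto
  then show ?thesis unfolding block_insert[OF assms] by auto
qed

lemma card_insert_block: "l < n \<Longrightarrow> l \<notin> L \<Longrightarrow> card ({..<n} - insert l L) = card ({..<n} - L) - 1"
  by (metis DiffI Diff_insert card_Diff_singleton lessThan_iff)

lemma current_index_empty: "current_index {} r = r"
  by (simp add: current_index_def)

lemma greedy_reaches_joint_contraction:
  "greedy_reaches M A L C \<Longrightarrow> A = joint_contraction M L C"
proof (induction rule: greedy_reaches.induct)
  case start
  have "{r. r < n \<and> r = a} = {a}" if "a < n" for a n :: nat using that by auto
  then show ?case
    by (intro eq_matI) (auto simp: joint_contraction_def current_index_empty)
next
  case (line A L C l)
  let ?i = "current_index L l" and ?A = "joint_contraction M L C"
  have A: "A = ?A" by (fact line.IH)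
  have bound: "?i + 1 < card ({..<dim_row M} - L)"
    using line.hyps(4) unfolding A
    by (simp add: greedy_choice_def valid_def joint_contraction_def)
  show ?case unfolding A
  proof (rule eq_matI)
    fix a b
    assume "a < dim_row (joint_contraction M (insert l L) C)"
      and "b < dim_col (joint_contraction M (insert l L) C)"
    then have "a < card ({..<dim_row M} - L) - 1" "b < card ({..<dim_col M} - C)"
      by (simp_all only: joint_contraction_def dim_row_mat dim_col_mat
          card_insert_block[OF line.hyps(2,3)])
    with bound show "contract (Line ?i) ?A $$ (a, b) = joint_contraction M (insert l L) C $$ (a, b)"
      by (simp add: joint_contraction_def card_insert_block[OF line.hyps(2,3)]
          sum_block_insert[OF line.hyps(3)])
  qed (simp_all add: joint_contraction_def card_insert_block[OF line.hyps(2,3)])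
next
  case (column A L C c)
  let ?j = "current_index C c" and ?A = "joint_contraction M L C"
  have A: "A = ?A" by (fact column.IH)
  have bound: "?j + 1 < card ({..<dim_col M} - C)"
    using column.hyps(4) unfolding A
    by (simp add: greedy_choice_def valid_def joint_contraction_def)
  show ?case unfolding A
  proof (rule eq_matI)
    fix a b
    assume "a < dim_row (joint_contraction M L (insert c C))"
      and "b < dim_col (joint_contraction M L (insert c C))"
    then have "a < card ({..<dim_row M} - L)" "b < card ({..<dim_col M} - C) - 1"
      by (simp_all only: joint_contraction_def dim_row_mat dim_col_mat
          card_insert_block[OF column.hyps(2,3)])
    with bound show "contract (Column ?j) ?A $$ (a, b) = joint_contraction M L (insert c C) $$ (a, b)"
      by (simp add: joint_contraction_def card_insert_block[OF column.hyps(2,3)]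
          sum_block_insert[OF column.hyps(3)] sum.distrib)
  qed (simp_all add: joint_contraction_def card_insert_block[OF column.hyps(2,3)])
qed

text \<open>
  The machine model consists of structured programs for a word RAM.
  A state consists of named registers and a memory of cells, all holding natural numbers.
  Evaluating an expression node and executing a statement each cost one time unit.
  Subtraction is truncated, comparison yields 0 or 1, and a test succeeds iff its value is
  nonzero.
\<close>

type_synonym state = "(string \<Rightarrow> nat) \<times> (nat \<Rightarrow> nat)"

datatype exp =
    Num nat
  | Reg string
  | Mem exp
  | Add exp exp
  | Sub exp exp
  | Mul exp exp
  | Less exp exp

fun val :: "exp \<Rightarrow> state \<Rightarrow> nat" where
  "val (Num n) s = n"
| "val (Reg x) s = fst s x"
| "val (Mem e) s = snd s (val e s)"
| "val (Add e1 e2) s = val e1 s + val e2 s"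
| "val (Sub e1 e2) s = val e1 s - val e2 s"
| "val (Mul e1 e2) s = val e1 s * val e2 s"
| "val (Less e1 e2) s = (if val e1 s < val e2 s then 1 else 0)"

fun cost :: "exp \<Rightarrow> nat" where
  "cost (Num n) = 1"
| "cost (Reg x) = 1"
| "cost (Mem e) = cost e + 1"
| "cost (Add e1 e2) = cost e1 + cost e2 + 1"
| "cost (Sub e1 e2) = cost e1 + cost e2 + 1"
| "cost (Mul e1 e2) = cost e1 + cost e2 + 1"
| "cost (Less e1 e2) = cost e1 + cost e2 + 1"

text \<open>
  Words hold the numbers below \<open>W\<close>. An expression may be evaluated only if the value of each of
  its subexpressions fits into a word; otherwise execution is stuck, so unit costs
  cannot be exploited by computing with huge numbers.
\<close>

fun fits :: "nat \<Rightarrow> exp \<Rightarrow> state \<Rightarrow> bool" where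
  "fits W (Num n) s \<longleftrightarrow> n < W"
| "fits W (Reg x) s \<longleftrightarrow> fst s x < W"
| "fits W (Mem e) s \<longleftrightarrow> fits W e s \<and> snd s (val e s) < W"
| "fits W (Add e1 e2) s \<longleftrightarrow> fits W e1 s \<and> fits W e2 s \<and> val e1 s + val e2 s < W"
| "fits W (Sub e1 e2) s \<longleftrightarrow> fits W e1 s \<and> fits W e2 s"
| "fits W (Mul e1 e2) s \<longleftrightarrow> fits W e1 s \<and> fits W e2 s \<and> val e1 s * val e2 s < W"
| "fits W (Less e1 e2) s \<longleftrightarrow> fits W e1 s \<and> fits W e2 s \<and> 1 < W"

datatype program =
    Skip
  | Assign string exp
  | Store exp exp
  | Seq program program
  | If exp program program
  | While exp program

text \<open>
  \<open>runs W prog s t s'\<close>: with word size \<open>W\<close>, the program started in \<open>s\<close> halts in \<open>s'\<close> after exactly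
  \<open>t\<close> time units.
\<close>

inductive runs :: "nat \<Rightarrow> program \<Rightarrow> state \<Rightarrow> nat \<Rightarrow> state \<Rightarrow> bool" for W where
  Skip: "runs W Skip s 1 s"
| Assign: "fits W e s \<Longrightarrow>
    runs W (Assign x e) s (cost e + 1) ((fst s)(x := val e s), snd s)"
| Store: "fits W a s \<Longrightarrow> fits W e s \<Longrightarrow>
    runs W (Store a e) s (cost a + cost e + 1) (fst s, (snd s)(val a s := val e s))"
| Seq: "runs W P s t s' \<Longrightarrow> runs W Q s' u s'' \<Longrightarrow>
    runs W (Seq P Q) s (t + u + 1) s''"
| IfTrue: "fits W e s \<Longrightarrow> val e s \<noteq> 0 \<Longrightarrow> runs W P s t s' \<Longrightarrow>
    runs W (If e P Q) s (cost e + t + 1) s'"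
| IfFalse: "fits W e s \<Longrightarrow> val e s = 0 \<Longrightarrow> runs W Q s t s' \<Longrightarrow>
    runs W (If e P Q) s (cost e + t + 1) s'"
| WhileFalse: "fits W e s \<Longrightarrow> val e s = 0 \<Longrightarrow>
    runs W (While e P) s (cost e + 1) s"
| WhileTrue: "fits W e s \<Longrightarrow> val e s \<noteq> 0 \<Longrightarrow> runs W P s t s' \<Longrightarrow>
    runs W (While e P) s' u s'' \<Longrightarrow>
    runs W (While e P) s (cost e + t + u + 1) s''"

inductive_cases runs_elims:
  "runs W Skip s t s'" "runs W (Assign x e) s t s'" "runs W (Store a e) s t s'"
  "runs W (Seq P Q) s t s'" "runs W (If e P Q) s t s'" "runs W (While e P) s t s'"

lemma runs_deterministic:
  "runs W P s t s' \<Longrightarrow> runs W P s u s'' \<Longrightarrow> u = t \<and> s'' = s'"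
proof (induction arbitrary: u s'' rule: runs.induct)
  case (Skip s)
  from Skip.prems show ?case by (rule runs_elims(1)) simp
next
  case (Assign e s x)
  from Assign.prems show ?case by (rule runs_elims(2)) simp
next
  case (Store a s e)
  from Store.prems show ?case by (rule runs_elims(3)) simp
next
  case (Seq P s t1 s1 Q t2 s2)
  from Seq.prems obtain u1 r u2
    where "u = Suc (u1 + u2)" "runs W P s u1 r" "runs W Q r u2 s''"
    by (rule runs_elims(4))
  with Seq.IH(1)[of u1 r] Seq.IH(2)[of u2 s''] show ?case by simp
next
  case (IfTrue e s P t1 s1 Q)
  from IfTrue.prems obtain v where "u = Suc (cost e + v)" "runs W P s v s''"
    by (rule runs_elims(5)) (rule that, assumption+, simp add: IfTrue.hyps)
  with IfTrue.IH[of v s''] show ?case by simp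
next
  case (IfFalse e s Q t1 s1 P)
  from IfFalse.prems obtain v where "u = Suc (cost e + v)" "runs W Q s v s''"
    by (rule runs_elims(5)) (simp add: IfFalse.hyps, rule that)
  with IfFalse.IH[of v s''] show ?case by simp
next
  case (WhileFalse e s P)
  from WhileFalse.prems show ?case
    by (rule runs_elims(6)) (use WhileFalse.hyps in simp_all)
next
  case (WhileTrue e s P t1 s1 t2 s2)
  from WhileTrue.prems obtain u1 r u2
    where "u = Suc (cost e + u1 + u2)" "runs W P s u1 r" "runs W (While e P) r u2 s''"
    by (rule runs_elims(6)) (simp add: WhileTrue.hyps, rule that)
  with WhileTrue.IH(1)[of u1 r] WhileTrue.IH(2)[of u2 s''] show ?case by simp
qed

text \<open>
  Input: the dimensions in registers \<open>p\<close> and \<open>q\<close>, and the entries in row-major order in the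
  cells from 0 on. Output: the two sets as bit vectors in the \<open>p + q\<close> cells following the input.
\<close>

definition input_state :: "nat mat \<Rightarrow> state" where
  "input_state M =
    ((\<lambda>_. 0)(''p'' := dim_row M, ''q'' := dim_col M),
     \<lambda>a. if a < dim_row M * dim_col M then M $$ (a div dim_col M, a mod dim_col M) else 0)"

definition output_lines :: "nat \<Rightarrow> nat \<Rightarrow> state \<Rightarrow> nat set" where
  "output_lines p q s = {l. l < p \<and> snd s (p * q + l) = 1}"

definition output_columns :: "nat \<Rightarrow> nat \<Rightarrow> state \<Rightarrow> nat set" where
  "output_columns p q s = {c. c < q \<and> snd s (p * q + p + c) = 1}"

end

theory Submission
  imports Defs
begin

text \<open>
  A valid contraction of line \<open>i\<close> keeps all adjacent pairs of ones. The new adjacent pairs are exactly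
  the pairs in lines \<open>i - 1, i + 1\<close> or \<open>i, i + 2\<close> whose columns differ by at most one, so their number
  is computed in one pass over four lines. Hence the densities after all line contractions are
  compared in time \<open>O(p q)\<close>, and, transposing, so are those after all column contractions. The
  contraction itself is done in place in time \<open>O(p q)\<close> as well. Every round but the last removes a line
  or a column, so there are at most \<open>p + q \<le> 2 p q\<close> rounds, which take \<open>O(p\<^sup>2 q\<^sup>2)\<close> in total.
\<close>

section \<open>The density gained by a contraction\<close>

text \<open>Evaluating every density from scratch costs order pq for each of the p + q candidates in
  each of the p + q rounds; for q = 1 this is cubic in p where a quadratic bound is required. Hence
  the program never computes a density: the density before the round is common to all candidates, so
  comparing the increases suffices. The second obstacle is the word size, which must be a fixed
  power of pq + 1. One invariant serves the whole run: all registers and cells are at most B. Every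
  expression of the program has bounded length, so its subexpressions stay below
  \<open>B ^ 200\<close>, and all that remains to be checked at an assignment is that the stored
  value is at most B. The third is a mismatch of indices: the program contracts lines of the current
  matrix, but has to report lines of the input. A search through the output bits translates the
  former into the latter.\<close>

definition entry :: "nat mat \<Rightarrow> nat \<Rightarrow> nat \<Rightarrow> nat" where
  "entry A r c = (if r < dim_row A \<and> c < dim_col A then A $$ (r, c) else 0)"

text \<open>The three summands count pairs in equal columns and in the two diagonal directions. Line
  distance two matters because merging neighbouring lines turns it into one. The zero padding in
  \<open>entry\<close> takes care of the last column and of the last two lines.\<close>

definition link :: "nat mat \<Rightarrow> nat \<Rightarrow> nat" where
  "link A r = (\<Sum>c<dim_col A. entry A r c * entry A (r + 2) c +
     entry A r c * entry A (r + 2) (c + 1) + entry A r (c + 1) * entry A (r + 2) c)"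

definition clash :: "nat mat \<Rightarrow> nat \<Rightarrow> nat" where
  "clash A i = (\<Sum>c<dim_col A. entry A i c * entry A (i + 1) c)"

definition line_gain :: "nat mat \<Rightarrow> nat \<Rightarrow> nat" where
  "line_gain A i = (if i = 0 then 0 else link A (i - 1)) + link A i"

fun gain :: "nat mat \<Rightarrow> contraction \<Rightarrow> nat" where
  "gain A (Line i) = line_gain A i"
| "gain A (Column j) = line_gain (transpose_mat A) j"

lemma binary_iff: "binary A \<longleftrightarrow> (\<forall>r<dim_row A. \<forall>c<dim_col A. A $$ (r, c) \<le> 1)"
proof -
  have "n \<in> {0, 1} \<longleftrightarrow> n \<le> 1" for n :: nat by auto
  moreover have "elements_mat A = {A $$ (r, c) | r c. r < dim_row A \<and> c < dim_col A}"
    using elements_matI[OF carrier_matI[of A]] by (intro equalityI subsetI CollectI) (metis elements_matD, blast)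
  ultimately show ?thesis unfolding binary_def subset_iff by (simp del: insert_iff) blast
qed

lemma binary_entry: "binary A \<Longrightarrow> entry A r c \<le> 1"
  by (simp add: binary_iff entry_def)

lemma entry_mult_le:
  assumes "binary A"
  shows "entry A r c * entry A r' d \<le> 1"
  using mult_mono[OF binary_entry[OF assms, of r c] binary_entry[OF assms, of r' d]] by simp

lemma binary_transpose [simp]: "binary (transpose_mat A) = binary A"
  by (auto simp: binary_iff)

lemma mem_one_positions: "x \<in> one_positions A \<longleftrightarrow> entry A (fst x) (snd x) = 1"
  by (cases x) (auto simp: one_positions_def entry_def)

lemma finite_one_positions: "finite (one_positions A)"
  by (rule finite_subset[of _ "{..<dim_row A} \<times> {..<dim_col A}"]) (auto simp: one_positions_def)

definition adjacent :: "nat \<times> nat \<Rightarrow> nat \<times> nat \<Rightarrow> bool" where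
  "adjacent x y \<longleftrightarrow> max \<bar>int (fst x) - int (fst y)\<bar> \<bar>int (snd x) - int (snd y)\<bar> = 1"

lemma adjacent_iff:
  "adjacent (r, c) (r', d) \<longleftrightarrow>
     (r \<noteq> r' \<or> c \<noteq> d) \<and> r \<le> r' + 1 \<and> r' \<le> r + 1 \<and> c \<le> d + 1 \<and> d \<le> c + 1"
  unfolding adjacent_def fst_conv snd_conv by linarith

lemma density_adjacent:
  "density A = card {{x, y} | x y. x \<in> one_positions A \<and> y \<in> one_positions A \<and> adjacent x y}"
  unfolding density_def adjacent_def by (rule arg_cong[of _ _ card]) fastforce

lemma contract_Column_transpose:
  "contract (Column j) A = transpose_mat (contract (Line j) (transpose_mat A))"
  by (rule eq_matI) auto

text \<open>Only the merged line can leave {0, 1}, and for bits a and b the condition a + b \<le> 1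
  is equivalent to a * b = 0. A sum of such products vanishes iff each of them does, so a single
  counter decides validity.\<close>

lemma valid_Line_iff:
  assumes "binary A"
  shows "valid (Line i) A \<longleftrightarrow> i + 1 < dim_row A \<and> clash A i = 0"
proof (cases "i + 1 < dim_row A")
  case True
  have "binary (contract (Line i) A) \<longleftrightarrow> (\<forall>c<dim_col A. A $$ (i, c) + A $$ (i + 1, c) \<le> 1)"
    (is "?l \<longleftrightarrow> ?r")
  proof
    assume ?l
    show ?r
    proof (intro allI impI)
      fix c assume "c < dim_col A"
      with \<open>?l\<close> True have "contract (Line i) A $$ (i, c) \<le> 1"
        unfolding binary_iff by (simp del: index_mat)
      with True \<open>c < dim_col A\<close> show "A $$ (i, c) + A $$ (i + 1, c) \<le> 1" by simp
    qed
  next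
    assume ?r
    then show ?l using assms True by (auto simp: binary_iff)
  qed
  also have "\<dots> \<longleftrightarrow> (\<forall>c<dim_col A. entry A i c * entry A (i + 1) c = 0)"
  proof (intro all_cong)
    fix c assume "c < dim_col A"
    with True assms have "A $$ (i, c) \<le> 1" "A $$ (i + 1, c) \<le> 1" by (auto simp: binary_iff)
    with \<open>c < dim_col A\<close> True
    show "A $$ (i, c) + A $$ (i + 1, c) \<le> 1 \<longleftrightarrow> entry A i c * entry A (i + 1) c = 0"
      by (auto simp: entry_def)
  qed
  finally show ?thesis using True by (simp add: valid_def clash_def Ball_def del: contract.simps)
qed (simp add: valid_def)

lemma valid_Column_iff: "valid (Column j) A \<longleftrightarrow> valid (Line j) (transpose_mat A)"
  unfolding valid_def contract_Column_transpose by simp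

text \<open>Swapping coordinates preserves ones and adjacency, and an injective map acts injectively
  on sets of positions. Columns thus need no density argument of their own.\<close>

lemma density_transpose: "density (transpose_mat A) = density A"
proof -
  have *: "{{x, y} | x y. x \<in> one_positions (transpose_mat A) \<and> y \<in> one_positions (transpose_mat A) \<and> adjacent x y}
    = (\<lambda>e. prod.swap ` e) ` {{x, y} | x y. x \<in> one_positions A \<and> y \<in> one_positions A \<and> adjacent x y}"
    (is "?l = _ ` ?r")
  proof (intro equalityI subsetI)
    fix e assume "e \<in> ?l"
    then obtain x y where e: "e = {x, y}" "x \<in> one_positions (transpose_mat A)"
      "y \<in> one_positions (transpose_mat A)" "adjacent x y" by blast
    then have "{prod.swap x, prod.swap y} \<in> ?r"
      by (intro CollectI exI[of _ "prod.swap x"] exI[of _ "prod.swap y"])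
        (auto simp: one_positions_def adjacent_def)
    moreover have "e = prod.swap ` {prod.swap x, prod.swap y}" by (simp add: e)
    ultimately show "e \<in> (\<lambda>e. prod.swap ` e) ` ?r" by blast
  next
    fix e assume "e \<in> (\<lambda>e. prod.swap ` e) ` ?r"
    then obtain x y where e: "e = {prod.swap x, prod.swap y}" "x \<in> one_positions A"
      "y \<in> one_positions A" "adjacent x y" by auto
    then show "e \<in> ?l"
      by (intro CollectI exI[of _ "prod.swap x"] exI[of _ "prod.swap y"])
        (auto simp: one_positions_def adjacent_def)
  qed
  have "inj_on ((`) prod.swap) X" for X :: "(nat \<times> nat) set set"
    by (rule inj_on_subset[OF inj_image_eq_iff[THEN iffD1, THEN injI]]) auto
  then show ?thesis unfolding density_adjacent * by (rule card_image)
qed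

section \<open>Pairs of ones two lines apart\<close>

definition link_pairs :: "nat mat \<Rightarrow> nat \<Rightarrow> (nat \<times> nat) set set" where
  "link_pairs A r = {{(r, c), (r + 2, d)} | c d. (r, c) \<in> one_positions A \<and>
     (r + 2, d) \<in> one_positions A \<and> \<bar>int c - int d\<bar> \<le> 1}"

lemma card_filter_sum:
  fixes N :: nat
  assumes "\<And>c. f c \<le> (1::nat)"
  shows "(\<Sum>c<N. f c) = card {c. c < N \<and> f c = 1}"
proof -
  have "(\<Sum>c<N. f c) = (\<Sum>c<N. if f c = 1 then 1 else 0)"
    by (rule sum.cong) (use assms in \<open>auto simp: le_Suc_eq\<close>)
  also have "\<dots> = card {c \<in> {..<N}. f c = 1}" by (simp add: sum.If_cases Int_def)
  finally show ?thesis by simp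
qed

text \<open>The lines \<open>r\<close> and \<open>r + 2\<close> differ, so an unordered pair
  determines the column of each of its ones and may be counted as an ordered pair. Splitting by d =
  c, d = c + 1 and c = d + 1 gives the three sums of \<open>link\<close>.\<close>

lemma card_link_pairs:
  assumes "binary A"
  shows "finite (link_pairs A r)" "card (link_pairs A r) = link A r"
proof -
  let ?N = "dim_col A" and ?e = "entry A r" and ?f = "entry A (r + 2)"
  let ?h = "\<lambda>(c, d). {(r, c), (r + 2, d)}"
  define S where "S = {(c, d). ?e c = 1 \<and> ?f d = 1 \<and> \<bar>int c - int d\<bar> \<le> 1}"
  define S0 where "S0 = {c. c < ?N \<and> ?e c * ?f c = 1}"
  define S1 where "S1 = {c. c < ?N \<and> ?e c * ?f (c + 1) = 1}"
  define S2 where "S2 = {c. c < ?N \<and> ?e (c + 1) * ?f c = 1}"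
  note le = entry_mult_le[OF assms]
  have lt: "?e c = 1 \<Longrightarrow> c < ?N" "?f c = 1 \<Longrightarrow> c < ?N" for c
    by (auto simp: entry_def split: if_splits)
  have pairs: "link_pairs A r = ?h ` S"
    by (auto simp: link_pairs_def S_def mem_one_positions)
  have inj: "inj_on ?h S" by (auto simp: inj_on_def doubleton_eq_iff)
  have S: "S = (\<lambda>c. (c, c)) ` S0 \<union> (\<lambda>c. (c, c + 1)) ` S1 \<union> (\<lambda>c. (c + 1, c)) ` S2"
  proof (intro equalityI subsetI)
    fix x assume "x \<in> S"
    then obtain c d where x: "x = (c, d)" "?e c = 1" "?f d = 1" "\<bar>int c - int d\<bar> \<le> 1"
      by (auto simp: S_def)
    from x(4) have "d = c \<or> d = c + 1 \<or> c = d + 1" by linarith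
    then show "x \<in> (\<lambda>c. (c, c)) ` S0 \<union> (\<lambda>c. (c, c + 1)) ` S1 \<union> (\<lambda>c. (c + 1, c)) ` S2"
      using x lt(1)[of c] lt(2)[of d] by (auto simp: S0_def S1_def S2_def)
  qed (auto simp: S_def S0_def S1_def S2_def)
  have fin: "finite S0" "finite S1" "finite S2" by (auto simp: S0_def S1_def S2_def)
  then have "finite S" by (simp add: S)
  then show "finite (link_pairs A r)" by (simp add: pairs)
  have "card S = card S0 + card S1 + card S2"
  proof -
    have "card S = card ((\<lambda>c. (c, c)) ` S0) + card ((\<lambda>c. (c, c + 1)) ` S1) + card ((\<lambda>c. (c + 1, c)) ` S2)"
      unfolding S using fin by (subst card_Un_disjoint, (auto)[3])+ simp
    then show ?thesis by (simp add: card_image inj_on_def)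
  qed
  moreover have "link A r = card S0 + card S1 + card S2"
    unfolding link_def S0_def S1_def S2_def sum.distrib
    by (simp only: card_filter_sum[of "\<lambda>c. ?e c * ?f c", OF le]
        card_filter_sum[of "\<lambda>c. ?e c * ?f (c + 1)", OF le]
        card_filter_sum[of "\<lambda>c. ?e (c + 1) * ?f c", OF le])
  ultimately show "card (link_pairs A r) = link A r" by (simp only: pairs card_image[OF inj])
qed

text \<open>Validity makes the induced map on the ones injective, so adjacent ones stay adjacent, and the
  only new adjacent pairs are those counted by \<open>line_gain\<close>.\<close>

lemma density_contract_Line:
  assumes bin: "binary A" and val: "valid (Line i) A"
  shows "density (contract (Line i) A) = density A + line_gain A i"
proof -
  let ?B = "contract (Line i) A" and ?P = "one_positions A"
  \<comment> \<open>\<open>f\<close> sends a one of \<open>A\<close> to its position after the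
    contraction.\<close>
  define f :: "nat \<times> nat \<Rightarrow> nat \<times> nat" where "f = (\<lambda>(r, c). (if r \<le> i then r else r - 1, c))"
  define E where "E = {{x, y} | x y. x \<in> ?P \<and> y \<in> ?P \<and> adjacent x y}"
  \<comment> \<open>\<open>E'\<close> describes the adjacent pairs of the contracted matrix by
    positions in \<open>A\<close>, so that old and new pairs are compared inside one set.\<close>
  define E' where "E' = {{x, y} | x y. x \<in> ?P \<and> y \<in> ?P \<and> adjacent (f x) (f y)}"
  have E'I: "{x, y} \<in> E'" if "x \<in> ?P" "y \<in> ?P" "adjacent (f x) (f y)" for x y
    unfolding E'_def using that by blast
  have i: "i + 1 < dim_row A" and "clash A i = 0" using val by (simp_all add: valid_Line_iff[OF bin])
  then have zero: "\<not> (entry A i c = 1 \<and> entry A (i + 1) c = 1)" for c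
  proof (cases "c < dim_col A")
    case True
    then have "entry A i c * entry A (i + 1) c = 0"
      using \<open>clash A i = 0\<close> unfolding clash_def by (simp only: sum_eq_0_iff finite_lessThan lessThan_iff)
    then show ?thesis by auto
  qed (simp add: entry_def)
  have entry_B: "entry ?B r c = (if r < i then entry A r c
      else if r = i then entry A i c + entry A (i + 1) c else entry A (r + 1) c)" for r c
    using i by (auto simp: entry_def)
  \<comment> \<open>Only lines \<open>i\<close> and \<open>i + 1\<close> have a common image, so a
    collision needs two ones of one column in these lines, which \<open>zero\<close>
    excludes.\<close>
  have inj: "inj_on f ?P"
  proof (rule inj_onI)
    fix x y assume xy: "x \<in> ?P" "y \<in> ?P" "f x = f y"
    obtain r c r' d where eq: "x = (r, c)" "y = (r', d)" by fastforce
    have "d = c" using xy(3) by (simp add: eq f_def)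
    moreover from this have "\<not> (r = i \<and> r' = i + 1)" "\<not> (r' = i \<and> r = i + 1)"
      using zero[of c] xy(1,2) by (auto simp: eq mem_one_positions)
    moreover have "(if r \<le> i then r else r - 1) = (if r' \<le> i then r' else r' - 1)"
      using xy(3) by (simp add: eq f_def)
    then have "r = r' \<or> (r = i \<and> r' = i + 1) \<or> (r' = i \<and> r = i + 1)" by presburger
    ultimately show "x = y" by (auto simp: eq)
  qed
  have image: "one_positions ?B = f ` ?P"
  proof (intro equalityI subsetI)
    fix x assume x: "x \<in> one_positions ?B"
    obtain r c where rc: "x = (r, c)" by fastforce
    have "entry ?B r c = 1" using x by (simp add: rc mem_one_positions)
    then consider "r \<le> i" "entry A r c = 1" | "r \<ge> i" "entry A (r + 1) c = 1"
      unfolding entry_B using binary_entry[OF bin, of i c] 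
      by (auto split: if_splits simp: add_is_1)
    then show "x \<in> f ` ?P"
    proof cases
      case 1
      then show ?thesis by (intro image_eqI[of _ _ "(r, c)"]) (auto simp: rc f_def mem_one_positions)
    next
      case 2
      then show ?thesis by (intro image_eqI[of _ _ "(r + 1, c)"]) (auto simp: rc f_def mem_one_positions)
    qed
  next
    fix x assume "x \<in> f ` ?P"
    then obtain r c where rc: "x = f (r, c)" "entry A r c = 1" by (auto simp: mem_one_positions)
    consider "r < i" | "r = i" | "r = i + 1" | "r > i + 1" by linarith
    then show "x \<in> one_positions ?B"
    proof cases
      case 2
      then have "entry A (i + 1) c = 0" using zero[of c] binary_entry[OF bin, of "i + 1" c] rc by auto
      with 2 rc show ?thesis by (simp add: f_def mem_one_positions entry_B del: contract.simps)
    next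
      case 3
      then have "entry A i c = 0" using zero[of c] binary_entry[OF bin, of i c] rc by auto
      with 3 rc show ?thesis by (simp add: f_def mem_one_positions entry_B del: contract.simps)
    qed (use rc in \<open>auto simp: f_def mem_one_positions entry_B simp del: contract.simps\<close>)
  qed
  have "{{x, y} | x y. x \<in> one_positions ?B \<and> y \<in> one_positions ?B \<and> adjacent x y} = (`) f ` E'"
    (is "?l = _")
  proof (intro equalityI subsetI)
    fix e assume "e \<in> ?l"
    then obtain x y where xy: "x \<in> ?P" "y \<in> ?P" "e = {f x, f y}" "adjacent (f x) (f y)"
      unfolding image by blast
    then have "e = f ` {x, y}" by simp
    moreover have "{x, y} \<in> E'" using xy by (intro E'I)
    ultimately show "e \<in> (`) f ` E'" by blast
  next
    fix e assume "e \<in> (`) f ` E'"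
    then obtain x y where "x \<in> ?P" "y \<in> ?P" "e = {f x, f y}" "adjacent (f x) (f y)"
      unfolding E'_def by auto
    then show "e \<in> ?l" unfolding image by blast
  qed
  moreover have "inj_on ((`) f) E'"
    by (rule inj_on_subset[OF inj_on_image_Pow[OF inj]]) (auto simp: E'_def)
  ultimately have "density ?B = card E'" by (simp add: density_adjacent card_image del: contract.simps)
  define N where "N = (if i = 0 then {} else link_pairs A (i - 1)) \<union> link_pairs A i"
  have N_sub: "link_pairs A r \<subseteq> E'" if "r = i \<or> r + 1 = i" for r
  proof
    fix e assume "e \<in> link_pairs A r"
    then obtain c d where e: "e = {(r, c), (r + 2, d)}" "(r, c) \<in> ?P" "(r + 2, d) \<in> ?P"
      "\<bar>int c - int d\<bar> \<le> 1" unfolding link_pairs_def by blast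
    have "c \<le> d + 1" "d \<le> c + 1" using e(4) by linarith+
    with that have "adjacent (f (r, c)) (f (r + 2, d))" by (auto simp: f_def adjacent_iff)
    then show "e \<in> E'" unfolding e(1) by (intro E'I e)
  qed
  have "E' = E \<union> N"
  proof (intro equalityI subsetI)
    fix e assume "e \<in> E'"
    then obtain x0 y0 where e0: "e = {x0, y0}" "x0 \<in> ?P" "y0 \<in> ?P" "adjacent (f x0) (f y0)"
      unfolding E'_def by blast
    obtain x y where e: "e = {x, y}" "x \<in> ?P" "y \<in> ?P" "adjacent (f x) (f y)" "fst x \<le> fst y"
    proof (cases "fst x0 \<le> fst y0")
      case True
      then show ?thesis using that[of x0 y0] e0 by simp
    next
      case False
      have "adjacent (f y0) (f x0)" using e0(4) by (simp add: adjacent_def max_def abs_minus_commute)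
      with False show ?thesis using that[of y0 x0] e0 by (simp add: insert_commute)
    qed
    show "e \<in> E \<union> N"
    proof (cases "adjacent x y")
      case True
      with e(2,3) show ?thesis unfolding e(1) E_def by blast
    next
      case False
      obtain r c r' d where xy: "x = (r, c)" "y = (r', d)" by fastforce
      have ne: "x \<noteq> y" using e(4) by (auto simp: adjacent_def)
      have cd: "c \<le> d + 1" "d \<le> c + 1" using e(4) unfolding xy f_def adjacent_iff case_prod_conv by auto
      \<comment> \<open>The columns are already within distance one and \<open>x\<close> is not
        below \<open>y\<close>, so failing adjacency leaves only equal positions or a line distance
        of at least two.\<close>
      have "r' \<le> r + 1 \<longrightarrow> r = r' \<and> c = d" "r \<le> r'"
        using False cd e(5) unfolding xy adjacent_iff by auto
      with ne have "r + 2 \<le> r'" by (auto simp: xy)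
      moreover have "(if r' \<le> i then r' else r' - 1) \<le> (if r \<le> i then r else r - 1) + 1"
        using e(4) unfolding xy f_def adjacent_iff case_prod_conv by simp
      \<comment> \<open>A contraction shortens a line distance by at most one, and only if both
        merged lines lie between the two given ones. So the distance is exactly two and
        \<open>r\<close> is \<open>i - 1\<close> or \<open>i\<close>.\<close>
      ultimately have r: "r' = r + 2" "r = i \<or> r + 1 = i" by (auto split: if_splits)
      have "\<bar>int c - int d\<bar> \<le> 1" using cd by linarith
      with e(2,3) have "{x, y} \<in> link_pairs A r" unfolding xy r(1) link_pairs_def by blast
      then show ?thesis using r(2) unfolding N_def e(1) by (cases "r = i") auto
    qed
  next
    fix e assume "e \<in> E \<union> N"
    then show "e \<in> E'"
    proof
      assume "e \<in> E"
      then obtain x y where e: "e = {x, y}" "x \<in> ?P" "y \<in> ?P" "adjacent x y"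
        unfolding E_def by blast
      obtain r c r' d where xy: "x = (r, c)" "y = (r', d)" by fastforce
      have "x \<noteq> y" using e(4) by (auto simp: adjacent_def)
      \<comment> \<open>\<open>f\<close> never increases a distance, so adjacency could be lost only
        by two ones falling together; injectivity rules this out.\<close>
      then have "f x \<noteq> f y" by (simp add: inj_on_eq_iff[OF inj e(2,3)])
      then have "adjacent (f x) (f y)"
        using e(4) unfolding xy f_def adjacent_iff case_prod_conv by auto
      with e(2,3) show ?thesis unfolding e(1) by (intro E'I)
    next
      assume "e \<in> N"
      then show ?thesis using N_sub[of i] N_sub[of "i - 1"] unfolding N_def
        by (cases "i = 0") auto
    qed
  qed
  moreover have "e \<notin> E" if e: "e \<in> link_pairs A r" for e r
  proof
    assume "e \<in> E"
    then obtain x y where xy: "e = {x, y}" "adjacent x y" unfolding E_def by blast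
    from e obtain c d where "e = {(r, c), (r + 2, d)}" unfolding link_pairs_def by blast
    with xy have "adjacent (r, c) (r + 2, d) \<or> adjacent (r + 2, d) (r, c)"
      by (metis doubleton_eq_iff)
    then show False by (simp add: adjacent_iff)
  qed
  then have "E \<inter> N = {}" unfolding N_def by (cases "i = 0") auto
  moreover have "finite E"
    by (rule finite_subset[of _ "Pow ?P"]) (auto simp: E_def finite_one_positions)
  moreover have "finite N" by (auto simp: N_def card_link_pairs[OF bin])
  moreover have "card N = line_gain A i"
  proof (cases "i = 0")
    case False
    then have "link_pairs A (i - 1) \<inter> link_pairs A i = {}"
      by (auto simp: link_pairs_def doubleton_eq_iff)
    then show ?thesis using False
      by (simp add: N_def line_gain_def card_Un_disjoint card_link_pairs[OF bin])
  qed (simp add: N_def line_gain_def card_link_pairs[OF bin])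
  ultimately show ?thesis
    using \<open>density ?B = card E'\<close> by (simp add: card_Un_disjoint density_adjacent[of A] E_def del: contract.simps)
qed

lemma density_contract:
  assumes "binary A" "valid x A"
  shows "density (contract x A) = density A + gain A x"
proof (cases x)
  case (Column j)
  with assms density_contract_Line[of "transpose_mat A" j] show ?thesis
    by (simp add: valid_Column_iff contract_Column_transpose density_transpose del: contract.simps)
qed (use assms density_contract_Line in \<open>simp del: contract.simps\<close>)

text \<open>The summand \<open>density A\<close> cancels, so the greedy choice is a maximum of
  \<open>gain\<close>, which the scans can compute.\<close>

lemma greedy_choiceI:
  assumes "binary A" "valid x A" "\<And>y. valid y A \<Longrightarrow> gain A y \<le> gain A x"
  shows "greedy_choice A x"
  using assms by (simp add: greedy_choice_def density_contract)

section \<open>Timed total correctness\<close>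

definition bounded :: "nat \<Rightarrow> state \<Rightarrow> bool" where
  "bounded B s \<longleftrightarrow> 2 \<le> B \<and> (\<forall>x. fst s x \<le> B) \<and> (\<forall>a. snd s a \<le> B)"

fun small_literals :: "exp \<Rightarrow> bool" where
  "small_literals (Num n) \<longleftrightarrow> n \<le> 2"
| "small_literals (Reg x) \<longleftrightarrow> True"
| "small_literals (Mem e) \<longleftrightarrow> small_literals e"
| "small_literals (Add e1 e2) \<longleftrightarrow> small_literals e1 \<and> small_literals e2"
| "small_literals (Sub e1 e2) \<longleftrightarrow> small_literals e1 \<and> small_literals e2"
| "small_literals (Mul e1 e2) \<longleftrightarrow> small_literals e1 \<and> small_literals e2"
| "small_literals (Less e1 e2) \<longleftrightarrow> small_literals e1 \<and> small_literals e2"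

text \<open>Every node accounts for one factor B: a sum at most doubles the common bound and 2 \<le>
  B, a product adds exponents, and a memory read is at most B whatever its address.\<close>

lemma val_le_power_cost:
  assumes "bounded B s" "small_literals e"
  shows "val e s \<le> B ^ cost e"
  using assms(2)
proof (induction e)
  case (Mem e)
  have "snd s (val e s) \<le> B ^ 1" using assms(1) by (simp add: bounded_def)
  also have "\<dots> \<le> B ^ cost (Mem e)" using assms(1) by (intro power_increasing) (auto simp: bounded_def)
  finally show ?case by simp
next
  case (Add e1 e2)
  have B: "2 \<le> B" using assms(1) by (simp add: bounded_def)
  have "val e1 s \<le> B ^ (cost e1 + cost e2)" "val e2 s \<le> B ^ (cost e1 + cost e2)"
    using Add B by (auto intro: order_trans[OF _ power_increasing])
  then have "val (Add e1 e2) s \<le> 2 * B ^ (cost e1 + cost e2)" by simp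
  also have "\<dots> \<le> B * B ^ (cost e1 + cost e2)" using B by (intro mult_right_mono) auto
  finally show ?case by simp
next
  case (Sub e1 e2)
  have "val (Sub e1 e2) s \<le> B ^ cost e1" using Sub by auto
  also have "\<dots> \<le> B ^ cost (Sub e1 e2)" using assms(1) by (intro power_increasing) (auto simp: bounded_def)
  finally show ?case .
next
  case (Mul e1 e2)
  have "val (Mul e1 e2) s \<le> B ^ cost e1 * B ^ cost e2" using Mul by (auto intro: mult_mono)
  also have "\<dots> \<le> B ^ cost (Mul e1 e2)" 
    unfolding power_add[symmetric] using assms(1) by (intro power_increasing) (auto simp: bounded_def)
  finally show ?case .
qed (use assms(1) in \<open>auto simp: bounded_def\<close>)

lemma fits_of_bounded:
  assumes "bounded B s" "small_literals e" "B ^ cost e < W"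
  shows "fits W e s"
proof -
  have B: "2 \<le> B" using assms(1) by (simp add: bounded_def)
  have le: "B ^ cost e \<le> B ^ cost e'" if "cost e \<le> cost e'" for e e'
    using B that by (intro power_increasing) auto
  show ?thesis
    using assms(2,3)
  proof (induction e)
    case (Mem e)
    have "B ^ cost e < W" using le[of e "Mem e"] Mem.prems(2) by (simp del: power_Suc)
    then show ?case using Mem val_le_power_cost[OF assms(1), of "Mem e"] by simp
  next
    case (Add e1 e2)
    then show ?case
      using le[of e1 "Add e1 e2"] le[of e2 "Add e1 e2"] val_le_power_cost[OF assms(1), of "Add e1 e2"] by simp
  next
    case (Sub e1 e2)
    then show ?case using le[of e1 "Sub e1 e2"] le[of e2 "Sub e1 e2"] by simp
  next
    case (Mul e1 e2)
    then show ?case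
      using le[of e1 "Mul e1 e2"] le[of e2 "Mul e1 e2"] val_le_power_cost[OF assms(1), of "Mul e1 e2"] by simp
  next
    case (Less e1 e2)
    have "1 \<le> B ^ cost (Less e1 e2)" using B by simp
    then have "1 < W" using Less.prems(2) by linarith
    then show ?case using Less le[of e1 "Less e1 e2"] le[of e2 "Less e1 e2"] by simp
  next
    case (Num n)
    then show ?case using B by simp
  next
    case (Reg x)
    have "fst s x \<le> B" using assms(1) by (simp add: bounded_def)
    then show ?case using Reg by simp
  qed
qed

text \<open>The longest expression of the program, the update of \<open>v\<close> in
  \<open>tally\<close>, has cost 123; 200 is a round bound above it.\<close>

definition safe :: "exp \<Rightarrow> bool" where
  "safe e \<longleftrightarrow> small_literals e \<and> cost e < 200"

lemma fits_safe:
  assumes "bounded B s" "safe e"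
  shows "fits (B ^ 200) e s"
proof (rule fits_of_bounded[OF assms(1)])
  have "2 \<le> B" using assms(1) by (simp add: bounded_def)
  then show "B ^ cost e < B ^ 200"
    using assms(2) by (intro power_strict_increasing) (auto simp: safe_def)
qed (use assms(2) in \<open>simp add: safe_def\<close>)

text \<open>Total correctness within \<open>n\<close> steps. Keeping all registers and cells below \<open>B\<close> takes care
  of the word size, since a safe expression then fits into words of size \<open>B ^ 200\<close>.\<close>

definition halts :: "nat \<Rightarrow> program \<Rightarrow> state \<Rightarrow> nat \<Rightarrow> (state \<Rightarrow> bool) \<Rightarrow> bool" where
  "halts B P s n Q \<longleftrightarrow> (bounded B s \<longrightarrow>
     (\<exists>t s'. runs (B ^ 200) P s t s' \<and> t \<le> n \<and> bounded B s' \<and> Q s'))"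

lemma haltsI:
  "(bounded B s \<Longrightarrow> \<exists>t s'. runs (B ^ 200) P s t s' \<and> t \<le> n \<and> bounded B s' \<and> Q s') \<Longrightarrow> halts B P s n Q"
  by (simp add: halts_def)

lemma haltsE:
  assumes "halts B P s n Q" "bounded B s"
  obtains t s' where "runs (B ^ 200) P s t s'" "t \<le> n" "bounded B s'" "Q s'"
  using assms by (auto simp: halts_def)

lemma halts_conseq: "halts B P s n Q \<Longrightarrow> (\<And>s'. Q s' \<Longrightarrow> R s') \<Longrightarrow> n \<le> k \<Longrightarrow> halts B P s k R"
  unfolding halts_def by (meson order_trans)

text \<open>Nesting \<open>halts\<close> as the postcondition of the first part avoids naming an
  intermediate assertion; boundedness of the intermediate state is supplied by \<open>halts\<close>
  itself.\<close>

lemma halts_Seq: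
  assumes "halts B P s k (\<lambda>s'. halts B P' s' l Q)" "k + l + 1 \<le> n"
  shows "halts B (Seq P P') s n Q"
proof (rule haltsI)
  assume "bounded B s"
  with assms(1) obtain t s' where 1: "runs (B ^ 200) P s t s'" "t \<le> k" "bounded B s'" "halts B P' s' l Q"
    by (rule haltsE)
  from 1(4,3) obtain u s'' where 2: "runs (B ^ 200) P' s' u s''" "u \<le> l" "bounded B s''" "Q s''"
    by (rule haltsE)
  have "t + u + 1 \<le> n" using 1(2) 2(2) assms(2) by simp
  with 2 runs.Seq[OF 1(1) 2(1)]
  show "\<exists>t s'. runs (B ^ 200) (Seq P P') s t s' \<and> t \<le> n \<and> bounded B s' \<and> Q s'" by blast
qed

lemma halts_If:
  assumes "safe e" "val e s \<noteq> 0 \<Longrightarrow> halts B P s k Q" "val e s = 0 \<Longrightarrow> halts B P' s k Q"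
    "cost e + k + 1 \<le> n"
  shows "halts B (If e P P') s n Q"
proof (rule haltsI)
  assume b: "bounded B s"
  note f = fits_safe[OF b assms(1)]
  show "\<exists>t s'. runs (B ^ 200) (If e P P') s t s' \<and> t \<le> n \<and> bounded B s' \<and> Q s'"
  proof (cases "val e s = 0")
    case True
    obtain t s' where 1: "runs (B ^ 200) P' s t s'" "t \<le> k" "bounded B s'" "Q s'"
      using haltsE[OF assms(3)[OF True] b] by blast
    have "cost e + t + 1 \<le> n" using 1(2) assms(4) by simp
    with 1 runs.IfFalse[OF f True 1(1)] show ?thesis by blast
  next
    case False
    obtain t s' where 1: "runs (B ^ 200) P s t s'" "t \<le> k" "bounded B s'" "Q s'"
      using haltsE[OF assms(2)[OF False] b] by blast
    have "cost e + t + 1 \<le> n" using 1(2) assms(4) by simp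
    with 1 runs.IfTrue[OF f False 1(1)] show ?thesis by blast
  qed
qed

text \<open>The measure \<open>f\<close> proves termination and bounds the time at once: at most
  \<open>f s\<close> iterations with their tests, then one failing test.\<close>

lemma halts_While:
  fixes f :: "state \<Rightarrow> nat"
  assumes "I s" "safe e"
    and step: "\<And>s. I s \<Longrightarrow> val e s \<noteq> 0 \<Longrightarrow> halts B P s k (\<lambda>s'. I s' \<and> f s' < f s)"
    and exit: "\<And>s. I s \<Longrightarrow> val e s = 0 \<Longrightarrow> Q s"
    and "f s * (k + cost e + 1) + cost e + 1 \<le> n"
  shows "halts B (While e P) s n Q"
proof (rule haltsI)
  assume "bounded B s"
  with assms(1) have "\<exists>t s'. runs (B ^ 200) (While e P) s t s' \<and>
    t \<le> f s * (k + cost e + 1) + cost e + 1 \<and> bounded B s' \<and> Q s'"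
  proof (induction "f s" arbitrary: s rule: less_induct)
    case less
    note fit = fits_safe[OF less.prems(2) assms(2)]
    show ?case
    proof (cases "val e s = 0")
      case True
      with less.prems exit runs.WhileFalse[OF fit True, of P] show ?thesis
        by (intro exI[of _ "cost e + 1"] exI[of _ s]) simp
    next
      case False
      obtain t s' where 1: "runs (B ^ 200) P s t s'" "t \<le> k" "bounded B s'" "I s' \<and> f s' < f s"
        using haltsE[OF step[OF less.prems(1) False] less.prems(2)] by blast
      then obtain u s'' where 2: "runs (B ^ 200) (While e P) s' u s''"
        "u \<le> f s' * (k + cost e + 1) + cost e + 1" "bounded B s''" "Q s''"
        using less.hyps[of s'] by blast
      have "(f s' + 1) * (k + cost e + 1) \<le> f s * (k + cost e + 1)"
        using 1(4) by (intro mult_right_mono) auto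
      then have "cost e + t + u + 1 \<le> f s * (k + cost e + 1) + cost e + 1"
        using 1(2) 2(2) by (simp add: algebra_simps)
      with 2 runs.WhileTrue[OF fit False 1(1) 2(1)] show ?thesis by blast
    qed
  qed
  with assms(5) show "\<exists>t s'. runs (B ^ 200) (While e P) s t s' \<and> t \<le> n \<and> bounded B s' \<and> Q s'"
    by (meson order_trans)
qed

text \<open>A weakest precondition that the simplifier can evaluate outright. The conditions
  \<open>val e s \<le> B\<close> keep the state bounded, and loops get \<open>False\<close> because
  they are handled by \<open>halts_While\<close> only.\<close>

fun loop_free_wp :: "nat \<Rightarrow> program \<Rightarrow> (state \<Rightarrow> bool) \<Rightarrow> state \<Rightarrow> bool" where
  "loop_free_wp B Skip Q s \<longleftrightarrow> Q s"
| "loop_free_wp B (Assign x e) Q s \<longleftrightarrow> safe e \<and> val e s \<le> B \<and> Q ((fst s)(x := val e s), snd s)"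
| "loop_free_wp B (Store a e) Q s \<longleftrightarrow>
     safe a \<and> safe e \<and> val e s \<le> B \<and> Q (fst s, (snd s)(val a s := val e s))"
| "loop_free_wp B (Seq P P') Q s \<longleftrightarrow> loop_free_wp B P (loop_free_wp B P' Q) s"
| "loop_free_wp B (If e P P') Q s \<longleftrightarrow>
     safe e \<and> (if val e s \<noteq> 0 then loop_free_wp B P Q s else loop_free_wp B P' Q s)"
| "loop_free_wp B (While e P) Q s \<longleftrightarrow> False"

fun loop_free_steps :: "program \<Rightarrow> nat" where
  "loop_free_steps Skip = 1"
| "loop_free_steps (Assign x e) = cost e + 1"
| "loop_free_steps (Store a e) = cost a + cost e + 1"
| "loop_free_steps (Seq P P') = loop_free_steps P + loop_free_steps P' + 1"
| "loop_free_steps (If e P P') = cost e + max (loop_free_steps P) (loop_free_steps P') + 1"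
| "loop_free_steps (While e P) = 0"

lemma halts_loop_free:
  "loop_free_wp B P Q s \<Longrightarrow> loop_free_steps P \<le> n \<Longrightarrow> halts B P s n Q"
proof (induction P arbitrary: Q s n)
  case Skip
  with runs.Skip[of "B ^ 200" s] show ?case unfolding halts_def by fastforce
next
  case (Assign x e)
  show ?case
  proof (rule haltsI)
    assume b: "bounded B s"
    then have "bounded B ((fst s)(x := val e s), snd s)" using Assign by (simp add: bounded_def)
    with Assign runs.Assign[OF fits_safe[OF b], of e x]
    show "\<exists>t s'. runs (B ^ 200) (Assign x e) s t s' \<and> t \<le> n \<and> bounded B s' \<and> Q s'" by fastforce
  qed
next
  case (Store a e)
  show ?case
  proof (rule haltsI)
    assume b: "bounded B s"
    then have "bounded B (fst s, (snd s)(val a s := val e s))" using Store by (simp add: bounded_def)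
    with Store runs.Store[OF fits_safe[OF b] fits_safe[OF b], of a e]
    show "\<exists>t s'. runs (B ^ 200) (Store a e) s t s' \<and> t \<le> n \<and> bounded B s' \<and> Q s'" by fastforce
  qed
next
  case (Seq P P')
  then have "halts B P s (loop_free_steps P) (loop_free_wp B P' Q)" by simp
  then have "halts B P s (loop_free_steps P) (\<lambda>s'. halts B P' s' (loop_free_steps P') Q)"
    using Seq.IH(2) by (auto elim: halts_conseq)
  then show ?case by (rule halts_Seq) (use Seq in simp)
next
  case (If e P P')
  then show ?case
    by (intro halts_If[where k = "max (loop_free_steps P) (loop_free_steps P')"]) auto
qed simp

section \<open>The program\<close>

text \<open>
  The current matrix has \<open>m\<close> lines and \<open>n\<close> columns and is kept in the input cells with the original
  stride \<open>q\<close>. Lines and columns are processed by the same code, which works on an \<open>M \<times> N\<close> matrix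
  with strides \<open>U\<close> and \<open>V\<close>: the current matrix (\<open>D = 0\<close>) or its transpose (\<open>D = 1\<close>).
  A scan keeps in \<open>t\<close> the successor of the best gain (0 if no contraction is valid) and in \<open>d\<close>, \<open>k\<close> a
  contraction attaining it. While it is at line \<open>i\<close>, the registers \<open>w\<close> and \<open>v\<close> hold the
  links of lines \<open>i - 1\<close> and \<open>i\<close>, and \<open>x\<close> counts the columns where lines \<open>i\<close> and \<open>i + 1\<close> clash.
  The output bits start at cell \<open>b\<close>, and \<open>g\<close> is cleared in order to stop.
\<close>

definition cell_address :: "exp \<Rightarrow> exp \<Rightarrow> exp" where
  "cell_address r c = Add (Mul r (Reg ''U'')) (Mul c (Reg ''V''))"

text \<open>The program's counterpart of \<open>entry\<close>. Expressions have no conditional, so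
  the range test is a factor 0 or 1. A cell is read even for positions outside the matrix, which is
  harmless since every cell is at most B.\<close>

definition lookup :: "exp \<Rightarrow> exp \<Rightarrow> exp" where
  "lookup r c = Mul (Mul (Less r (Reg ''M'')) (Less c (Reg ''N''))) (Mem (cell_address r c))"

definition tally :: program where
  "tally = (let i = Reg ''i''; i1 = Add i (Num 1); i2 = Add i (Num 2); c = Reg ''c''; c1 = Add c (Num 1) in
     Seq (Assign ''v'' (Add (Reg ''v'') (Add (Add (Mul (lookup i c) (lookup i2 c))
         (Mul (lookup i c) (lookup i2 c1))) (Mul (lookup i c1) (lookup i2 c)))))
    (Seq (Assign ''x'' (Add (Reg ''x'') (Mul (lookup i c) (lookup i1 c))))
         (Assign ''c'' c1)))"

definition tally_line :: program where
  "tally_line = Seq (Seq (Assign ''c'' (Num 0)) (Seq (Assign ''v'' (Num 0)) (Assign ''x'' (Num 0))))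
     (While (Less (Reg ''c'') (Reg ''N'')) tally)"

definition update_best :: program where
  "update_best = (let score = Add (Add (Reg ''w'') (Reg ''v'')) (Num 1) in
     Seq (If (Less (Reg ''x'') (Num 1))
           (If (Less (Reg ''t'') score)
             (Seq (Assign ''t'' score) (Seq (Assign ''k'' (Reg ''i'')) (Assign ''d'' (Reg ''D''))))
             Skip)
           Skip)
    (Seq (Assign ''w'' (Reg ''v'')) (Assign ''i'' (Add (Reg ''i'') (Num 1)))))"

definition scan :: program where
  "scan = Seq (Seq (Assign ''w'' (Num 0)) (Assign ''i'' (Num 0)))
     (While (Less (Add (Reg ''i'') (Num 1)) (Reg ''M'')) (Seq tally_line update_best))"

section \<open>Finding a contraction of maximal gain\<close>

definition stored :: "state \<Rightarrow> nat mat \<Rightarrow> bool" where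
  "stored s X \<longleftrightarrow> fst s ''M'' = dim_row X \<and> fst s ''N'' = dim_col X \<and>
     (\<forall>r<dim_row X. \<forall>c<dim_col X. snd s (r * fst s ''U'' + c * fst s ''V'') = X $$ (r, c))"

lemma stored_fun_upd [simp]:
  "y \<notin> {''M'', ''N'', ''U'', ''V''} \<Longrightarrow> stored (f(y := z), mem) X = stored (f, mem) X"
  by (auto simp: stored_def)

lemma val_lookup [simp]: "stored s X \<Longrightarrow> val (lookup r c) s = entry X (val r s) (val c s)"
  by (simp add: lookup_def cell_address_def entry_def stored_def)

lemma small_literals_lookup [simp]:
  "small_literals (lookup r c) \<longleftrightarrow> small_literals r \<and> small_literals c"
  by (auto simp: lookup_def cell_address_def)

lemma cost_lookup [simp]: "cost (lookup r c) = 2 * cost r + 2 * cost c + 12"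
  by (simp add: lookup_def cell_address_def)

lemma halts_tally_line:
  assumes st: "stored s X" and bin: "binary X" and B: "3 * dim_col X + 1 \<le> B"
  shows "halts B tally_line s (300 * dim_col X + 20)
    (\<lambda>s'. s' = ((fst s)(''c'' := dim_col X, ''v'' := link X (fst s ''i''), ''x'' := clash X (fst s ''i'')), snd s))"
proof -
  let ?i = "fst s ''i''" and ?N = "dim_col X"
  define lk where "lk c = entry X ?i c * entry X (?i + 2) c +
     entry X ?i c * entry X (?i + 2) (c + 1) + entry X ?i (c + 1) * entry X (?i + 2) c" for c
  define cl where "cl c = entry X ?i c * entry X (?i + 1) c" for c
  \<comment> \<open>The state after \<open>k\<close> columns is an explicit function of
    \<open>k\<close>, so the loop invariant merely says that the state is some
    \<open>\<sigma> k\<close>.\<close>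
  define \<sigma> where "\<sigma> k = ((fst s)(''c'' := k, ''v'' := \<Sum>c<k. lk c, ''x'' := \<Sum>c<k. cl c), snd s)" for k
  note e1 = entry_mult_le[OF bin]
  have lk3: "lk c \<le> 3" for c
    unfolding lk_def using e1[of ?i c "?i + 2" c] e1[of ?i c "?i + 2" "c + 1"] e1[of ?i "c + 1" "?i + 2" c]
    by linarith
  have cl1: "cl c \<le> 1" for c unfolding cl_def by (rule e1)
  have sums: "(\<Sum>c<k. lk c) \<le> 3 * k" "(\<Sum>c<k. cl c) \<le> k" for k
    using sum_bounded_above[of "{..<k}" lk 3] sum_bounded_above[of "{..<k}" cl 1] lk3 cl1 by auto
  have loop: "halts B (While (Less (Reg ''c'') (Reg ''N'')) tally) (\<sigma> 0) (?N * 290 + 4)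
    (\<lambda>s'. s' = \<sigma> ?N)"
  proof (rule halts_While[where I = "\<lambda>s'. \<exists>k\<le>?N. s' = \<sigma> k" and f = "\<lambda>s'. ?N - fst s' ''c''" and k = 286])
    show "\<exists>k\<le>?N. \<sigma> 0 = \<sigma> k" by blast
    fix s' assume "\<exists>k\<le>?N. s' = \<sigma> k"
    then obtain k where k: "k \<le> ?N" "s' = \<sigma> k" by blast
    have N: "fst s ''N'' = ?N" using st by (simp add: stored_def)
    show "s' = \<sigma> ?N" if "val (Less (Reg ''c'') (Reg ''N'')) s' = 0"
      using that k N by (auto simp: \<sigma>_def split: if_splits)
    assume "val (Less (Reg ''c'') (Reg ''N'')) s' \<noteq> 0"
    with k N have less: "k < ?N" by (auto simp: \<sigma>_def split: if_splits)
    have *: "loop_free_wp B tally (\<lambda>s''. s'' = \<sigma> (Suc k)) (\<sigma> k)"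
      using st sums[of "Suc k"] less B
      by (auto simp: tally_def Let_def safe_def \<sigma>_def lk_def cl_def fun_eq_iff)
    show "halts B tally s' 286 (\<lambda>s''. (\<exists>k\<le>?N. s'' = \<sigma> k) \<and> ?N - fst s'' ''c'' < ?N - fst s' ''c'')"
    proof (rule halts_conseq[OF halts_loop_free[OF *[folded k(2)] order_refl]])
      show "loop_free_steps tally \<le> 286" by (simp add: tally_def Let_def)
      fix s'' assume "s'' = \<sigma> (Suc k)"
      then show "(\<exists>k\<le>?N. s'' = \<sigma> k) \<and> ?N - fst s'' ''c'' < ?N - fst s' ''c''"
        using less by (intro conjI exI[of _ "Suc k"]) (auto simp: \<sigma>_def k(2))
    qed
  qed (auto simp: safe_def \<sigma>_def)
  have eq: "\<sigma> ?N = ((fst s)(''c'' := ?N, ''v'' := link X ?i, ''x'' := clash X ?i), snd s)"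
    by (simp add: \<sigma>_def link_def clash_def lk_def cl_def)
  show ?thesis unfolding tally_line_def
  proof (rule halts_Seq[OF halts_conseq[OF halts_loop_free[OF _ order_refl] _ order_refl]])
    show "loop_free_wp B (Seq (Assign ''c'' (Num 0)) (Seq (Assign ''v'' (Num 0)) (Assign ''x'' (Num 0))))
      (\<lambda>s'. s' = \<sigma> 0) s"
      by (auto simp: safe_def \<sigma>_def)
    fix s' assume "s' = \<sigma> 0"
    with loop show "halts B (While (Less (Reg ''c'') (Reg ''N'')) tally) s' (?N * 290 + 4)
      (\<lambda>s'. s' = ((fst s)(''c'' := ?N, ''v'' := link X ?i, ''x'' := clash X ?i), snd s))"
      by (simp add: eq)
  qed simp
qed

lemma link_le:
  assumes "binary X"
  shows "link X r \<le> 3 * dim_col X"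
proof -
  note e1 = entry_mult_le[OF assms]
  have "link X r \<le> (\<Sum>c<dim_col X. 3)"
    unfolding link_def
  proof (rule sum_mono)
    fix c
    show "entry X r c * entry X (r + 2) c + entry X r c * entry X (r + 2) (c + 1) +
      entry X r (c + 1) * entry X (r + 2) c \<le> 3"
      using e1[of r c "r + 2" c] e1[of r c "r + 2" "c + 1"] e1[of r "c + 1" "r + 2" c] by linarith
  qed
  then show ?thesis by simp
qed

definition scan_registers :: "string set" where
  "scan_registers = {''w'', ''i'', ''c'', ''v'', ''x'', ''t'', ''k'', ''d''}"

text \<open>Stated relative to the initial state so that two scans can be chained: a scan either
  leaves the best candidate found before, or replaces it by a valid contraction of its own, whose
  direction is the current \<open>D\<close>.\<close>

definition improves :: "state \<Rightarrow> nat mat \<Rightarrow> state \<Rightarrow> bool" where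
  "improves s X s' \<longleftrightarrow> snd s' = snd s \<and> (\<forall>y. y \<notin> scan_registers \<longrightarrow> fst s' y = fst s y) \<and>
     fst s ''t'' \<le> fst s' ''t'' \<and>
     (fst s' ''t'' = fst s ''t'' \<and> fst s' ''k'' = fst s ''k'' \<and> fst s' ''d'' = fst s ''d'' \<or>
      valid (Line (fst s' ''k'')) X \<and> fst s' ''t'' = line_gain X (fst s' ''k'') + 1 \<and>
      fst s' ''d'' = fst s ''D'')"

lemma halts_scan:
  assumes st: "stored s X" and bin: "binary X" and B: "dim_row X + 6 * dim_col X + 1 \<le> B"
    and dims: "1 \<le> dim_row X" "1 \<le> dim_col X" and D: "fst s ''D'' \<le> 1"
  shows "halts B scan s (400 * (dim_row X * dim_col X) + 20)
    (\<lambda>s'. improves s X s' \<and> (\<forall>j. valid (Line j) X \<longrightarrow> line_gain X j < fst s' ''t''))"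
proof -
  let ?M = "dim_row X" and ?N = "dim_col X"
  \<comment> \<open>The index stops at \<open>?M - 1\<close> because the last line has no successor
    to be merged with.\<close>
  define I where "I s' \<longleftrightarrow> improves s X s' \<and> fst s' ''i'' \<le> ?M - 1 \<and>
    fst s' ''w'' = (if fst s' ''i'' = 0 then 0 else link X (fst s' ''i'' - 1)) \<and>
    (\<forall>j<fst s' ''i''. valid (Line j) X \<longrightarrow> line_gain X j < fst s' ''t'')" for s'
  have stored: "stored s' X" if "I s'" for s'
    using that st by (simp add: I_def improves_def stored_def scan_registers_def)
  show ?thesis unfolding scan_def
  proof (rule halts_Seq[OF halts_conseq[OF halts_loop_free[OF _ order_refl] _ order_refl]])
    show "loop_free_wp B (Seq (Assign ''w'' (Num 0)) (Assign ''i'' (Num 0))) I s"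
      by (simp add: safe_def I_def improves_def scan_registers_def)
    fix s0 assume "I s0"
    show "halts B (While (Less (Add (Reg ''i'') (Num 1)) (Reg ''M'')) (Seq tally_line update_best)) s0
      (?M * (300 * ?N + 80) + 6)
      (\<lambda>s'. improves s X s' \<and> (\<forall>j. valid (Line j) X \<longrightarrow> line_gain X j < fst s' ''t''))"
    proof (rule halts_While[where I = I and f = "\<lambda>s'. ?M - 1 - fst s' ''i''" and k = "300 * ?N + 60"])
      fix s1 assume I: "I s1"
      have M: "fst s1 ''M'' = ?M" using stored[OF I] by (simp add: stored_def)
      let ?i = "fst s1 ''i''"
      show "improves s X s1 \<and> (\<forall>j. valid (Line j) X \<longrightarrow> line_gain X j < fst s1 ''t'')"
        if "val (Less (Add (Reg ''i'') (Num 1)) (Reg ''M'')) s1 = 0"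
      proof -
        have "?M \<le> ?i + 1" using that M by (simp split: if_splits)
        then have "j < ?i" if "valid (Line j) X" for j using that by (simp add: valid_def)
        with I show ?thesis by (simp add: I_def)
      qed
      assume "val (Less (Add (Reg ''i'') (Num 1)) (Reg ''M'')) s1 \<noteq> 0"
      then have i: "?i + 1 < ?M" using M by (simp split: if_splits)
      let ?s2 = "((fst s1)(''c'' := ?N, ''v'' := link X ?i, ''x'' := clash X ?i), snd s1)"
      have valid: "valid (Line ?i) X \<longleftrightarrow> clash X ?i = 0" using i by (simp add: valid_Line_iff[OF bin])
      have w: "fst s1 ''w'' + link X ?i = line_gain X ?i" "fst s1 ''w'' \<le> 3 * ?N"
        using I link_le[OF bin] by (auto simp: I_def line_gain_def)
      have less_Suc: "(\<forall>j<Suc ?i. P j) \<longleftrightarrow> (\<forall>j<?i. P j) \<and> P ?i" for P by (auto simp: less_Suc_eq)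
      have D: "fst s1 ''D'' \<le> 1"
        using D I by (simp add: I_def improves_def scan_registers_def)
      \<comment> \<open>A score adds two links, each at most \<open>3 * ?N\<close>, and one; this is
        the origin of the term \<open>6 * dim_col X + 1\<close> in the assumption on
        \<open>B\<close>.\<close>
      have le_B: "fst s1 ''w'' + link X ?i + 1 \<le> B" "?i + 1 \<le> B" "fst s1 ''D'' \<le> B"
        using w(2) link_le[OF bin, of ?i] B i D by linarith+
      define better where "better \<longleftrightarrow> clash X ?i = 0 \<and> fst s1 ''t'' < fst s1 ''w'' + link X ?i + 1"
      define f where "f = (fst s1)(''c'' := ?N, ''v'' := link X ?i, ''x'' := clash X ?i)"
      define g where "g = (if better then
        f(''t'' := fst s1 ''w'' + link X ?i + 1, ''k'' := ?i, ''d'' := fst s1 ''D'') else f)"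
      define h where "h = g(''w'' := link X ?i, ''i'' := ?i + 1)"
      \<comment> \<open>Both tests are folded into \<open>better\<close>, so that for every
        postcondition there is a single final state to consider.\<close>
      have wp: "loop_free_wp B update_best Q (f, snd s1) \<longleftrightarrow> Q (h, snd s1)" for Q
        using le_B by (simp add: update_best_def Let_def safe_def f_def g_def h_def better_def)
      have "improves s X s1" using I by (simp add: I_def)
      then have imp: "improves s X (h, snd s1)"
        using valid w(1)
        by (cases better) (simp_all add: improves_def h_def g_def f_def scan_registers_def better_def)
      have hs: "h ''i'' = ?i + 1" "h ''w'' = link X ?i" by (simp_all add: h_def)
      have t: "fst s1 ''t'' \<le> h ''t''" "clash X ?i = 0 \<longrightarrow> line_gain X ?i < h ''t''"
        using w(1) by (auto simp: h_def g_def f_def better_def)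
      have "line_gain X j < h ''t''" if "j < ?i + 1" "valid (Line j) X" for j
      proof (cases "j = ?i")
        case True
        then show ?thesis using t(2) that valid by simp
      next
        case False
        then have "line_gain X j < fst s1 ''t''" using that I by (simp add: I_def)
        then show ?thesis using t(1) by simp
      qed
      with imp hs i have "I (h, snd s1)" by (simp add: I_def)
      then have wp: "loop_free_wp B update_best (\<lambda>s'. I s' \<and> ?M - 1 - fst s' ''i'' < ?M - 1 - ?i) (f, snd s1)"
        unfolding wp using i hs by simp
      show "halts B (Seq tally_line update_best) s1 (300 * ?N + 60)
        (\<lambda>s'. I s' \<and> ?M - 1 - fst s' ''i'' < ?M - 1 - ?i)"
      proof (rule halts_Seq[OF halts_conseq[OF halts_tally_line[OF stored[OF I] bin] _ order_refl]])
        show "3 * ?N + 1 \<le> B" using B by simp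
        fix s' assume s': "s' = ?s2"
        show "halts B update_best s' 39 (\<lambda>s'. I s' \<and> ?M - 1 - fst s' ''i'' < ?M - 1 - ?i)"
          unfolding s' f_def[symmetric]
          by (rule halts_loop_free[OF wp]) (simp add: update_best_def Let_def)
      qed simp
    next
      have "(?M - 1 - fst s0 ''i'') * (300 * ?N + 60 + 6) \<le> ?M * (300 * ?N + 80)"
        by (intro mult_mono) auto
      then show "(?M - 1 - fst s0 ''i'') * (300 * ?N + 60 + cost (Less (Add (Reg ''i'') (Num 1)) (Reg ''M'')) + 1)
        + cost (Less (Add (Reg ''i'') (Num 1)) (Reg ''M'')) + 1 \<le> ?M * (300 * ?N + 80) + 6" by simp
    qed (use \<open>I s0\<close> in \<open>simp_all add: safe_def\<close>)
  next
    have "?M * (300 * ?N + 80) = 300 * (?M * ?N) + 80 * ?M" by (simp add: algebra_simps)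
    moreover have "?M \<le> ?M * ?N" using dims by simp
    moreover have "loop_free_steps (Seq (Assign ''w'' (Num 0)) (Assign ''i'' (Num 0))) = 5" by simp
    ultimately show "loop_free_steps (Seq (Assign ''w'' (Num 0)) (Assign ''i'' (Num 0))) +
      (?M * (300 * ?N + 80) + 6) + 1 \<le> 400 * (?M * ?N) + 20" by linarith
  qed
qed

section \<open>From current indices to input indices\<close>

lemma current_index_Suc: "current_index L (Suc r) = current_index L r + (if r \<in> L then 0 else 1)"
proof -
  have "{..<Suc r} - L = (if r \<in> L then {..<r} - L else insert r ({..<r} - L))"
    by (auto simp: less_Suc_eq)
  then show ?thesis by (simp add: current_index_def)
qed

text \<open>The index starts at 0 and grows by one exactly after the positions outside
  \<open>L\<close>, so each value below the final one is the index of some position outside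
  \<open>L\<close>, namely the last one of its block.\<close>

lemma current_index_witness:
  assumes "i < current_index L n"
  obtains l where "l < n" "l \<notin> L" "current_index L l = i"
  using assms
proof (induction n arbitrary: thesis)
  case 0
  then show ?case by (simp add: current_index_def)
next
  case (Suc n)
  show ?case
  proof (cases "i < current_index L n")
    case True
    then show ?thesis using Suc.IH Suc.prems(1) by (metis less_SucI)
  next
    case False
    with Suc.prems(2) have "n \<notin> L" "current_index L n = i"
      by (auto simp: current_index_Suc split: if_splits)
    then show ?thesis using Suc.prems(1) by blast
  qed
qed

text \<open>\<open>j\<close> counts the blocks still to be skipped and drops only at a 0 bit. The
  sum in the test acts as a disjunction: the search goes on while blocks remain or the position is
  already contracted.\<close>

definition find_line :: program where
  "find_line = (let bit = Mem (Add (Reg ''b'') (Reg ''l'')) in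
     Seq (Seq (Assign ''l'' (Num 0)) (Assign ''j'' (Reg ''k'')))
    (While (Add bit (Reg ''j''))
       (Seq (Assign ''j'' (Sub (Reg ''j'') (Sub (Num 1) bit)))
            (Assign ''l'' (Add (Reg ''l'') (Num 1))))))"

lemma halts_find_line:
  assumes bits: "\<And>r. r < P \<Longrightarrow> snd s (fst s ''b'' + r) = (if r \<in> L then 1 else 0)"
    and l: "l < P" "l \<notin> L" "current_index L l = fst s ''k''"
    and B: "P + 1 \<le> B"
  shows "halts B find_line s (40 * P + 20) (\<lambda>s'. s' = ((fst s)(''l'' := l, ''j'' := 0), snd s))"
proof -
  define \<sigma> where "\<sigma> r = ((fst s)(''l'' := r, ''j'' := fst s ''k'' - current_index L r), snd s)" for r
  have k: "fst s ''k'' \<le> B"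
  proof -
    have "current_index L l \<le> card {..<l}" unfolding current_index_def by (intro card_mono) auto
    then show ?thesis using l B by simp
  qed
  let ?cond = "Add (Mem (Add (Reg ''b'') (Reg ''l''))) (Reg ''j'')"
  show ?thesis unfolding find_line_def Let_def
  proof (rule halts_Seq[OF halts_conseq[OF halts_loop_free[OF _ order_refl] _ order_refl]])
    show "loop_free_wp B (Seq (Assign ''l'' (Num 0)) (Assign ''j'' (Reg ''k''))) (\<lambda>s'. s' = \<sigma> 0) s"
      using k by (simp add: safe_def \<sigma>_def current_index_def)
    fix s' assume s': "s' = \<sigma> 0"
    show "halts B (While ?cond (Seq (Assign ''j'' (Sub (Reg ''j'') (Sub (Num 1) (Mem (Add (Reg ''b'') (Reg ''l''))))))
            (Assign ''l'' (Add (Reg ''l'') (Num 1))))) s' (40 * P + 6)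
      (\<lambda>s'. s' = ((fst s)(''l'' := l, ''j'' := 0), snd s))"
      unfolding s'
    proof (rule halts_While[where I = "\<lambda>s'. \<exists>r\<le>l. s' = \<sigma> r" and f = "\<lambda>s'. l - fst s' ''l''" and k = 20])
      show "\<exists>r\<le>l. \<sigma> 0 = \<sigma> r" by blast
      fix s1 assume "\<exists>r\<le>l. s1 = \<sigma> r"
      then obtain r where r: "r \<le> l" "s1 = \<sigma> r" by blast
      have bit: "snd s (fst s ''b'' + r) = (if r \<in> L then 1 else 0)" using bits l(1) r(1) by simp
      \<comment> \<open>An uncontracted position before \<open>l\<close> ends an earlier block, so
        \<open>j\<close> is still positive there and the loop does not stop too soon.\<close>
      have below: "current_index L r < fst s ''k''" if "r \<notin> L" "r < l"
        using current_index_less[OF that(2,1)] l(3) by simp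
      show "s1 = ((fst s)(''l'' := l, ''j'' := 0), snd s)" if "val ?cond s1 = 0"
      proof -
        have "r = l" using that below r bit by (cases "r < l") (auto simp: \<sigma>_def split: if_splits)
        then show ?thesis using r(2) l(3) by (simp add: \<sigma>_def)
      qed
      assume "val ?cond s1 \<noteq> 0"
      then have "r \<noteq> l" using r(2) bit l by (auto simp: \<sigma>_def)
      with r(1) have "r < l" by simp
      have "fst s ''k'' - current_index L r - (Suc 0 - (if r \<in> L then 1 else 0)) =
          fst s ''k'' - current_index L (Suc r)" by (simp add: current_index_Suc)
      then have "loop_free_wp B (Seq (Assign ''j'' (Sub (Reg ''j'') (Sub (Num 1) (Mem (Add (Reg ''b'') (Reg ''l''))))))
            (Assign ''l'' (Add (Reg ''l'') (Num 1)))) (\<lambda>s''. s'' = \<sigma> (Suc r)) s1"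
        using k B l(1) \<open>r < l\<close> by (simp add: r(2) \<sigma>_def safe_def bit fun_eq_iff)
      then show "halts B (Seq (Assign ''j'' (Sub (Reg ''j'') (Sub (Num 1) (Mem (Add (Reg ''b'') (Reg ''l''))))))
            (Assign ''l'' (Add (Reg ''l'') (Num 1)))) s1 20
          (\<lambda>s'. (\<exists>r\<le>l. s' = \<sigma> r) \<and> l - fst s' ''l'' < l - fst s1 ''l'')"
      proof (rule halts_conseq[OF halts_loop_free[OF _ order_refl]])
        fix s'' assume "s'' = \<sigma> (Suc r)"
        then show "(\<exists>r\<le>l. s'' = \<sigma> r) \<and> l - fst s'' ''l'' < l - fst s1 ''l''"
          using \<open>r < l\<close> by (intro conjI exI[of _ "Suc r"]) (auto simp: \<sigma>_def r(2))
      qed simp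
    qed (use l(1) in \<open>simp_all add: safe_def \<sigma>_def\<close>)
  qed simp
qed

section \<open>Contracting a line in place\<close>

definition shift_cells :: program where
  "shift_cells = (let r = Reg ''r''; r1 = Add r (Num 1); c = Reg ''c''; c1 = Add c (Num 1);
     here = cell_address r c; below = cell_address r1 c in
     Seq (Assign ''r'' (Reg ''k''))
    (While (Less r1 (Reg ''M''))
       (Seq (Assign ''c'' (Num 0))
       (Seq (While (Less c (Reg ''N''))
              (Seq (Store here (Add (Mul (Sub (Num 1) (Less (Reg ''k'') r)) (Mem here)) (Mem below)))
                   (Assign ''c'' c1)))
            (Assign ''r'' r1)))))"

text \<open>Injective addressing below \<open>sz\<close>: a store changes the entry of one position
  only, and never an output bit.\<close>

definition separated :: "nat \<Rightarrow> nat \<Rightarrow> nat \<Rightarrow> nat \<Rightarrow> nat \<Rightarrow> bool" where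
  "separated u v m n sz \<longleftrightarrow> (\<forall>r<m. \<forall>c<n. r * u + c * v < sz \<and>
     (\<forall>r'<m. \<forall>c'<n. r * u + c * v = r' * u + c' * v \<longrightarrow> r = r' \<and> c = c'))"

text \<open>The progress of the two loops: from line \<open>k\<close> on, the positions
  lexicographically before \<open>(r, c)\<close> are final and the others still hold the old
  matrix.\<close>

definition shifted :: "state \<Rightarrow> nat mat \<Rightarrow> nat \<Rightarrow> nat \<Rightarrow> nat \<Rightarrow> state \<Rightarrow> bool" where
  "shifted s X sz r c s' \<longleftrightarrow> (\<forall>y. y \<notin> {''r'', ''c''} \<longrightarrow> fst s' y = fst s y) \<and>
     (\<forall>a\<ge>sz. snd s' a = snd s a) \<and>
     (\<forall>r'<dim_row X. \<forall>c'<dim_col X. snd s' (r' * fst s ''U'' + c' * fst s ''V'') =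
        (if fst s ''k'' \<le> r' \<and> (r' < r \<or> r' = r \<and> c' < c)
         then contract (Line (fst s ''k'')) X $$ (r', c') else X $$ (r', c')))"

lemma halts_shift_cells:
  assumes st: "stored s X" and bin: "binary X"
    and sep: "separated (fst s ''U'') (fst s ''V'') (dim_row X) (dim_col X) sz"
    and k: "fst s ''k'' + 1 < dim_row X" and cols: "1 \<le> dim_col X"
    and B: "dim_row X + dim_col X + 2 \<le> B"
  shows "halts B shift_cells s (100 * (dim_row X * dim_col X) + 20) (shifted s X sz (dim_row X - 1) 0)"
proof -
  let ?M = "dim_row X" and ?N = "dim_col X" and ?k = "fst s ''k''"
    and ?U = "fst s ''U''" and ?V = "fst s ''V''"
  let ?r = "Reg ''r''" and ?c = "Reg ''c''"
  let ?r1 = "Add ?r (Num 1)"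
  let ?store = "Store (cell_address ?r ?c)
    (Add (Mul (Sub (Num 1) (Less (Reg ''k'') ?r)) (Mem (cell_address ?r ?c))) (Mem (cell_address ?r1 ?c)))"
  let ?body = "Seq ?store (Assign ''c'' (Add ?c (Num 1)))"
  let ?inner = "While (Less ?c (Reg ''N'')) ?body"
  let ?line = "Seq (Assign ''c'' (Num 0)) (Seq ?inner (Assign ''r'' ?r1))"
  have regs: "fst s' ''k'' = ?k" "fst s' ''M'' = ?M" "fst s' ''N'' = ?N" "fst s' ''U'' = ?U" "fst s' ''V'' = ?V"
    if "shifted s X sz r c s'" for r c s'
    using that st by (simp_all add: shifted_def stored_def)
  have step: "halts B ?body s1 50
      (\<lambda>s2. shifted s X sz r (Suc c) s2 \<and> fst s2 ''r'' = r \<and> fst s2 ''c'' = Suc c)"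
    if sh: "shifted s X sz r c s1" and rc: "fst s1 ''r'' = r" "fst s1 ''c'' = c"
      and bd: "?k \<le> r" "r + 1 < ?M" "c < ?N" for r c s1
  proof -
    \<comment> \<open>Neither \<open>(r, c)\<close> nor \<open>(r + 1, c)\<close> precedes
      \<open>(r, c)\<close>, so both cells still hold entries of \<open>X\<close>.\<close>
    have here: "snd s1 (r * ?U + c * ?V) = X $$ (r, c)" and below: "snd s1 (?U + r * ?U + c * ?V) = X $$ (r + 1, c)"
      using sh[unfolded shifted_def, THEN conjunct2, THEN conjunct2, rule_format, of r c]
        sh[unfolded shifted_def, THEN conjunct2, THEN conjunct2, rule_format, of "r + 1" c] bd
      by (simp_all add: algebra_simps)
    define z where "z = contract (Line ?k) X $$ (r, c)"
    have z: "(Suc 0 - (if ?k < r then Suc 0 else 0)) * X $$ (r, c) + X $$ (Suc r, c) = z"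
      using bd by (auto simp: z_def)
    have "X $$ (r, c) \<le> 1" "X $$ (Suc r, c) \<le> 1" using bin bd by (simp_all add: binary_iff)
    then have zB: "z \<le> B" using bd B unfolding z_def by auto
    define s2 where "s2 = ((fst s1)(''c'' := Suc c), (snd s1)(r * ?U + c * ?V := z))"
    have "shifted s X sz r (Suc c) s2"
      unfolding shifted_def
    proof (intro conjI allI impI)
      show "fst s2 y = fst s y" if "y \<notin> {''r'', ''c''}" for y
        using sh that by (simp add: shifted_def s2_def)
      show "snd s2 a = snd s a" if "sz \<le> a" for a
      proof -
        have "r * ?U + c * ?V < sz" using sep bd by (simp add: separated_def)
        then show ?thesis using sh that by (auto simp: shifted_def s2_def)
      qed
      fix r' c' assume rc': "r' < ?M" "c' < ?N"
      have old: "snd s1 (r' * ?U + c' * ?V) = (if ?k \<le> r' \<and> (r' < r \<or> r' = r \<and> c' < c)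
         then contract (Line ?k) X $$ (r', c') else X $$ (r', c'))"
        using sh rc' unfolding shifted_def by blast
      show "snd s2 (r' * ?U + c' * ?V) = (if ?k \<le> r' \<and> (r' < r \<or> r' = r \<and> c' < Suc c)
         then contract (Line ?k) X $$ (r', c') else X $$ (r', c'))"
      proof (cases "r' = r \<and> c' = c")
        case True
        then show ?thesis using bd by (simp add: s2_def z_def del: contract.simps)
      next
        case False
        then have "r' * ?U + c' * ?V \<noteq> r * ?U + c * ?V" using sep rc' bd unfolding separated_def
          by (metis add_lessD1)
        then have "snd s2 (r' * ?U + c' * ?V) = snd s1 (r' * ?U + c' * ?V)" by (simp add: s2_def)
        moreover have "r' = r \<and> c' < Suc c \<longleftrightarrow> r' = r \<and> c' < c" using False by auto
        ultimately show ?thesis using old by simp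
      qed
    qed
    moreover have "fst s2 ''r'' = r" "fst s2 ''c'' = Suc c" using rc by (simp_all add: s2_def)
    ultimately have Q: "shifted s X sz r (Suc c) s2 \<and> fst s2 ''r'' = r \<and> fst s2 ''c'' = Suc c" by blast
    have wp: "loop_free_wp B ?body Q s1 \<longleftrightarrow> Q s2" for Q
      using rc z zB here below regs[OF sh] bd B
      by (cases "?k < r") (simp_all add: cell_address_def safe_def s2_def)
    show ?thesis
    proof (rule halts_loop_free)
      show "loop_free_wp B ?body (\<lambda>s2. shifted s X sz r (Suc c) s2 \<and> fst s2 ''r'' = r \<and> fst s2 ''c'' = Suc c) s1"
        unfolding wp by (rule Q)
    qed (simp add: cell_address_def)
  qed
  have line: "halts B ?line s1 (70 * ?N + 20)
      (\<lambda>s2. shifted s X sz (Suc r) 0 s2 \<and> fst s2 ''r'' = Suc r)"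
    if sh: "shifted s X sz r 0 s1" and r: "fst s1 ''r'' = r" and bd: "?k \<le> r" "r + 1 < ?M" for r s1
  proof (rule halts_Seq[OF halts_loop_free[OF _ order_refl]])
    have sh': "shifted s X sz r 0 ((fst s1)(''c'' := 0), snd s1)"
      using sh by (simp add: shifted_def)
    have inner: "halts B ?inner ((fst s1)(''c'' := 0), snd s1) (60 * ?N + 4)
        (\<lambda>s2. shifted s X sz r ?N s2 \<and> fst s2 ''r'' = r)"
    proof (rule halts_While[where f = "\<lambda>s2. ?N - fst s2 ''c''" and k = 50 and
          I = "\<lambda>s2. shifted s X sz r (fst s2 ''c'') s2 \<and> fst s2 ''r'' = r \<and> fst s2 ''c'' \<le> ?N"])
      fix s2 assume I: "shifted s X sz r (fst s2 ''c'') s2 \<and> fst s2 ''r'' = r \<and> fst s2 ''c'' \<le> ?N"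
      note N = regs(3)[OF conjunct1[OF I]]
      show "shifted s X sz r ?N s2 \<and> fst s2 ''r'' = r" if "val (Less ?c (Reg ''N'')) s2 = 0"
      proof -
        have "fst s2 ''c'' = ?N" using that N I by (simp split: if_splits)
        then show ?thesis using I by metis
      qed
      assume "val (Less ?c (Reg ''N'')) s2 \<noteq> 0"
      then have less: "fst s2 ''c'' < ?N" using N by (simp split: if_splits)
      show "halts B ?body s2 50 (\<lambda>s'. (shifted s X sz r (fst s' ''c'') s' \<and> fst s' ''r'' = r \<and>
          fst s' ''c'' \<le> ?N) \<and> ?N - fst s' ''c'' < ?N - fst s2 ''c'')"
        by (rule halts_conseq[OF step[of r "fst s2 ''c''" s2]]) (use I less bd in auto)
    qed (use sh' r in \<open>simp_all add: safe_def\<close>)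
    \<comment> \<open>Lexicographically, being past the last column of line \<open>r\<close> is the
      same as standing at the start of line \<open>r + 1\<close>.\<close>
    have "loop_free_wp B (Assign ''r'' ?r1) (\<lambda>s2. shifted s X sz (Suc r) 0 s2 \<and> fst s2 ''r'' = Suc r) s2"
      if "shifted s X sz r ?N s2 \<and> fst s2 ''r'' = r" for s2
      using that B bd by (simp add: safe_def shifted_def less_Suc_eq)
    then have "halts B (Assign ''r'' ?r1) s2 4 (\<lambda>s2. shifted s X sz (Suc r) 0 s2 \<and> fst s2 ''r'' = Suc r)"
      if "shifted s X sz r ?N s2 \<and> fst s2 ''r'' = r" for s2
      using that by (intro halts_loop_free) simp_all
    then have "halts B (Seq ?inner (Assign ''r'' ?r1)) ((fst s1)(''c'' := 0), snd s1) (60 * ?N + 9)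
        (\<lambda>s2. shifted s X sz (Suc r) 0 s2 \<and> fst s2 ''r'' = Suc r)"
      by (intro halts_Seq[OF halts_conseq[OF inner _ order_refl]]) auto
    then show "loop_free_wp B (Assign ''c'' (Num 0)) (\<lambda>s'. halts B (Seq ?inner (Assign ''r'' ?r1)) s' (60 * ?N + 9)
        (\<lambda>s2. shifted s X sz (Suc r) 0 s2 \<and> fst s2 ''r'' = Suc r)) s1"
      by (simp add: safe_def)
  qed simp
  let ?s0 = "((fst s)(''r'' := ?k), snd s)"
  have "shifted s X sz ?k 0 ?s0" using st by (auto simp: shifted_def stored_def)
  then have outer: "halts B (While (Less ?r1 (Reg ''M'')) ?line) ?s0 (?M * (70 * ?N + 26) + 6)
      (shifted s X sz (?M - 1) 0)"
  proof (intro halts_While[where f = "\<lambda>s2. ?M - fst s2 ''r''" and k = "70 * ?N + 20" and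
        I = "\<lambda>s2. shifted s X sz (fst s2 ''r'') 0 s2 \<and> ?k \<le> fst s2 ''r'' \<and> fst s2 ''r'' \<le> ?M - 1"])
    fix s2 assume I: "shifted s X sz (fst s2 ''r'') 0 s2 \<and> ?k \<le> fst s2 ''r'' \<and> fst s2 ''r'' \<le> ?M - 1"
    note M = regs(2)[OF conjunct1[OF I]]
    show "shifted s X sz (?M - 1) 0 s2" if "val (Less ?r1 (Reg ''M'')) s2 = 0"
    proof -
      have "fst s2 ''r'' = ?M - 1" using that M I by (simp split: if_splits)
      then show ?thesis using I by metis
    qed
    assume "val (Less ?r1 (Reg ''M'')) s2 \<noteq> 0"
    then have less: "fst s2 ''r'' + 1 < ?M" using M by (simp split: if_splits)
    show "halts B ?line s2 (70 * ?N + 20) (\<lambda>s'. (shifted s X sz (fst s' ''r'') 0 s' \<and> ?k \<le> fst s' ''r'' \<and>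
        fst s' ''r'' \<le> ?M - 1) \<and> ?M - fst s' ''r'' < ?M - fst s2 ''r'')"
      by (rule halts_conseq[OF line[of "fst s2 ''r''" s2]]) (use I less in auto)
  next
    have "(?M - ?k) * (70 * ?N + 26) \<le> ?M * (70 * ?N + 26)" by (intro mult_right_mono) auto
    then show "(?M - fst ?s0 ''r'') * (70 * ?N + 20 + cost (Less ?r1 (Reg ''M'')) + 1)
        + cost (Less ?r1 (Reg ''M'')) + 1 \<le> ?M * (70 * ?N + 26) + 6"
      by (simp add: add.commute)
  qed (use k in \<open>simp_all add: safe_def\<close>)
  show ?thesis unfolding shift_cells_def Let_def
  proof (rule halts_Seq[OF halts_loop_free[OF _ order_refl]])
    show "loop_free_wp B (Assign ''r'' (Reg ''k'')) (\<lambda>s'. halts B (While (Less ?r1 (Reg ''M'')) ?line) s'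
        (?M * (70 * ?N + 26) + 6) (shifted s X sz (?M - 1) 0)) s"
      using outer k B by (simp add: safe_def)
    have "?M * (70 * ?N + 26) = 70 * (?M * ?N) + 26 * ?M" by (simp add: algebra_simps)
    moreover have "?M \<le> ?M * ?N" using cols by simp
    moreover have "loop_free_steps (Assign ''r'' (Reg ''k'')) = 2" by simp
    ultimately show "loop_free_steps (Assign ''r'' (Reg ''k'')) + (?M * (70 * ?N + 26) + 6) + 1
        \<le> 100 * (?M * ?N) + 20" by linarith
  qed
qed

definition contract_line :: program where
  "contract_line = Seq find_line (Seq (Store (Add (Reg ''b'') (Reg ''l'')) (Num 1)) shift_cells)"

lemma halts_contract_line:
  assumes st: "stored s X" and bin: "binary X"
    and sep: "separated (fst s ''U'') (fst s ''V'') (dim_row X) (dim_col X) sz" and sz: "sz \<le> fst s ''b''"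
    and k: "fst s ''k'' + 1 < dim_row X" and cols: "1 \<le> dim_col X"
    and B: "dim_row X + dim_col X + 2 \<le> B" "P + 1 \<le> B"
    and bits: "\<And>r. r < P \<Longrightarrow> snd s (fst s ''b'' + r) = (if r \<in> L then 1 else 0)"
    and l: "l < P" "l \<notin> L" "current_index L l = fst s ''k''"
  shows "halts B contract_line s (40 * P + 100 * (dim_row X * dim_col X) + 60)
    (\<lambda>s'. (\<forall>y. y \<notin> {''l'', ''j'', ''r'', ''c''} \<longrightarrow> fst s' y = fst s y) \<and>
       (\<forall>a\<ge>sz. snd s' a = ((snd s)(fst s ''b'' + l := 1)) a) \<and>
       (\<forall>r<dim_row X - 1. \<forall>c<dim_col X. snd s' (r * fst s ''U'' + c * fst s ''V'') =
          contract (Line (fst s ''k'')) X $$ (r, c)))"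
    (is "halts B contract_line s ?n ?Q")
proof -
  let ?s1 = "((fst s)(''l'' := l, ''j'' := 0), snd s)"
  let ?s2 = "((fst s)(''l'' := l, ''j'' := 0), (snd s)(fst s ''b'' + l := 1))"
  let ?T = "100 * (dim_row X * dim_col X) + 20"
  \<comment> \<open>Setting the output bit does not touch the matrix, since the bits start at
    \<open>b\<close>, at or beyond \<open>sz\<close>.\<close>
  have "r * fst s ''U'' + c * fst s ''V'' \<noteq> fst s ''b'' + l" if "r < dim_row X" "c < dim_col X" for r c
  proof -
    have "r * fst s ''U'' + c * fst s ''V'' < sz" using sep that by (simp add: separated_def)
    then show ?thesis using sz by linarith
  qed
  then have "stored ?s2 X" using st by (simp add: stored_def)
  then have shift: "halts B shift_cells ?s2 ?T (shifted ?s2 X sz (dim_row X - 1) 0)"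
    by (intro halts_shift_cells) (use bin sep k cols B in simp_all)
  have Q: "?Q s'" if "shifted ?s2 X sz (dim_row X - 1) 0 s'" for s'
  proof (intro conjI allI impI)
    show "fst s' y = fst s y" if "y \<notin> {''l'', ''j'', ''r'', ''c''}" for y
      using that \<open>shifted _ _ _ _ _ _\<close> by (simp add: shifted_def)
    show "snd s' a = ((snd s)(fst s ''b'' + l := 1)) a" if "sz \<le> a" for a
      using that \<open>shifted _ _ _ _ _ _\<close> by (simp add: shifted_def)
    fix r c assume rc: "r < dim_row X - 1" "c < dim_col X"
    have "snd s' (r * fst s ''U'' + c * fst s ''V'') = (if fst s ''k'' \<le> r
         then contract (Line (fst s ''k'')) X $$ (r, c) else X $$ (r, c))"
      using that rc by (simp add: shifted_def del: contract.simps)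
    moreover have "contract (Line (fst s ''k'')) X $$ (r, c) = X $$ (r, c)" if "\<not> fst s ''k'' \<le> r"
      using that rc by simp
    ultimately show "snd s' (r * fst s ''U'' + c * fst s ''V'') = contract (Line (fst s ''k'')) X $$ (r, c)"
      by (simp del: contract.simps)
  qed
  have "halts B (Seq (Store (Add (Reg ''b'') (Reg ''l'')) (Num 1)) shift_cells) ?s1 (?T + 10) ?Q"
  proof (rule halts_Seq[OF halts_loop_free[OF _ order_refl]])
    show "loop_free_wp B (Store (Add (Reg ''b'') (Reg ''l'')) (Num 1))
        (\<lambda>s'. halts B shift_cells s' ?T ?Q) ?s1"
      using halts_conseq[OF shift Q order_refl] B by (simp add: safe_def)
  qed simp
  then have seq: "halts B (Seq (Store (Add (Reg ''b'') (Reg ''l'')) (Num 1)) shift_cells) s' (?T + 10) ?Q"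
    if "s' = ?s1" for s' using that by simp
  show ?thesis
    unfolding contract_line_def
    by (rule halts_Seq[OF halts_conseq[OF halts_find_line[OF bits l B(2)] seq order_refl]]) simp_all
qed

section \<open>One round of the greedy algorithm\<close>

definition setup_lines :: program where
  "setup_lines = Seq (Assign ''M'' (Reg ''m'')) (Seq (Assign ''N'' (Reg ''n''))
     (Seq (Assign ''U'' (Reg ''q'')) (Seq (Assign ''V'' (Num 1)) (Assign ''D'' (Num 0)))))"

definition setup_columns :: program where
  "setup_columns = Seq (Assign ''M'' (Reg ''n'')) (Seq (Assign ''N'' (Reg ''m''))
     (Seq (Assign ''U'' (Num 1)) (Seq (Assign ''V'' (Reg ''q'')) (Assign ''D'' (Num 1)))))"

text \<open>\<open>t\<close> is reset only before the line scan, so that the column scan competes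
  against the best line.\<close>

definition select :: program where
  "select = Seq (Seq (Assign ''t'' (Num 0)) setup_lines) (Seq scan (Seq setup_columns scan))"

text \<open>The setup copies the dimensions before \<open>m\<close> or \<open>n\<close> is
  decremented, as \<open>contract_line\<close> needs the old size.\<close>

definition perform :: program where
  "perform = Seq (If (Reg ''d'')
      (Seq setup_columns (Seq (Assign ''b'' (Add (Mul (Reg ''p'') (Reg ''q'')) (Reg ''p'')))
        (Assign ''n'' (Sub (Reg ''n'') (Num 1)))))
      (Seq setup_lines (Seq (Assign ''b'' (Mul (Reg ''p'') (Reg ''q'')))
        (Assign ''m'' (Sub (Reg ''m'') (Num 1))))))
    contract_line"

definition greedy_round :: program where
  "greedy_round = Seq select (If (Reg ''t'') perform (Assign ''g'' (Num 0)))"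

definition greedy_program :: program where
  "greedy_program = Seq (Seq (Assign ''m'' (Reg ''p'')) (Seq (Assign ''n'' (Reg ''q'')) (Assign ''g'' (Num 1))))
     (While (Reg ''g'') greedy_round)"

text \<open>Cells of the input area outside the current dimensions are left unspecified, since
  contractions leave stale entries there. The inclusions for \<open>L\<close> and \<open>C\<close>
  ensure that the output bits determine both sets.\<close>

definition represents :: "nat mat \<Rightarrow> nat mat \<Rightarrow> nat set \<Rightarrow> nat set \<Rightarrow> state \<Rightarrow> bool" where
  "represents M A L C s \<longleftrightarrow> greedy_reaches M A L C \<and> binary A \<and> 1 \<le> dim_row A \<and> 1 \<le> dim_col A \<and>
     L \<subseteq> {..<dim_row M} \<and> C \<subseteq> {..<dim_col M} \<and>
     fst s ''p'' = dim_row M \<and> fst s ''q'' = dim_col M \<and>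
     fst s ''m'' = dim_row A \<and> fst s ''n'' = dim_col A \<and>
     (\<forall>r<dim_row A. \<forall>c<dim_col A. snd s (r * dim_col M + c) = A $$ (r, c)) \<and>
     (\<forall>l<dim_row M. snd s (dim_row M * dim_col M + l) = (if l \<in> L then 1 else 0)) \<and>
     (\<forall>c<dim_col M. snd s (dim_row M * dim_col M + dim_row M + c) = (if c \<in> C then 1 else 0))"

text \<open>The current matrix is the joint contraction, so its dimensions count the uncontracted
  input lines and columns. This links the bound on \<open>k\<close> to the existence of an input
  line with that index.\<close>

lemma represents_dims:
  assumes "represents M A L C s"
  shows "dim_row A = current_index L (dim_row M)" "dim_col A = current_index C (dim_col M)"
    "dim_row A \<le> dim_row M" "dim_col A \<le> dim_col M"
proof -
  have A: "A = joint_contraction M L C"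
    using assms greedy_reaches_joint_contraction by (auto simp: represents_def)
  show "dim_row A = current_index L (dim_row M)" "dim_col A = current_index C (dim_col M)"
    by (simp_all add: A joint_contraction_def current_index_def)
  moreover have "current_index S n \<le> n" for S n
    using card_mono[of "{..<n}" "{..<n} - S"] by (simp add: current_index_def)
  ultimately show "dim_row A \<le> dim_row M" "dim_col A \<le> dim_col M" by simp_all
qed

definition chosen :: "state \<Rightarrow> contraction" where
  "chosen s = (if fst s ''d'' = 0 then Line (fst s ''k'') else Column (fst s ''k''))"

lemma halts_select:
  assumes rep: "represents M A L C s" and B: "100 * (dim_row M * dim_col M) \<le> B"
  shows "halts B select s (800 * (dim_row M * dim_col M) + 100)
    (\<lambda>s'. snd s' = snd s \<and> (\<forall>y\<in>{''p'', ''q'', ''m'', ''n'', ''g''}. fst s' y = fst s y) \<and>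
      (if fst s' ''t'' = 0 then \<nexists>x. valid x A else greedy_choice A (chosen s')))"
    (is "halts B select s _ ?Q")
proof -
  let ?p = "dim_row M" and ?q = "dim_col M"
  note rep' = rep[unfolded represents_def] and dims = represents_dims(3,4)[OF rep]
  have bin: "binary A" and pos: "1 \<le> dim_row A" "1 \<le> dim_col A" using rep' by simp_all
  have "?p \<le> ?p * ?q" "?q \<le> ?p * ?q" "1 \<le> ?p * ?q" using pos dims by auto
  then have le_B: "7 * ?p + 7 * ?q + 10 \<le> B" using B by linarith
  have time: "dim_row A * dim_col A \<le> ?p * ?q" using dims by (intro mult_mono) auto
  then have time': "dim_col A * dim_row A \<le> ?p * ?q" by (simp add: mult.commute)
  let ?s1 = "((fst s)(''t'' := 0, ''M'' := dim_row A, ''N'' := dim_col A, ''U'' := ?q, ''V'' := 1, ''D'' := 0), snd s)"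
  have wp1: "loop_free_wp B (Seq (Assign ''t'' (Num 0)) setup_lines) (\<lambda>s'. s' = ?s1) s"
    using rep' dims le_B by (simp add: setup_lines_def safe_def)
  have scan1: "halts B scan ?s1 (400 * (?p * ?q) + 20)
      (\<lambda>s'. improves ?s1 A s' \<and> (\<forall>j. valid (Line j) A \<longrightarrow> line_gain A j < fst s' ''t''))"
    by (rule halts_conseq[OF halts_scan]) (use rep' dims le_B time in \<open>auto simp: stored_def\<close>)
  have rest: "halts B (Seq setup_columns scan) s2 (400 * (?p * ?q) + 40) ?Q"
    if imp: "improves ?s1 A s2" and all: "\<forall>j. valid (Line j) A \<longrightarrow> line_gain A j < fst s2 ''t''" for s2
  proof -
    let ?T = "transpose_mat A"
    let ?s3 = "((fst s2)(''M'' := dim_col A, ''N'' := dim_row A, ''U'' := 1, ''V'' := ?q, ''D'' := 1), snd s2)"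
    have s2: "snd s2 = snd s" "fst s2 ''p'' = ?p" "fst s2 ''q'' = ?q" "fst s2 ''m'' = dim_row A"
      "fst s2 ''n'' = dim_col A" "fst s2 ''g'' = fst s ''g''"
      using imp rep' by (simp_all add: improves_def scan_registers_def)
    have wp: "loop_free_wp B setup_columns (\<lambda>s'. s' = ?s3) s2"
      using s2 dims le_B by (simp add: setup_columns_def safe_def)
    have cells: "snd s (r + c * ?q) = A $$ (c, r)" if "r < dim_col A" "c < dim_row A" for r c
      using rep' that by (metis add.commute)
    have scan2: "halts B scan ?s3 (400 * (?p * ?q) + 20)
      (\<lambda>s'. improves ?s3 ?T s' \<and> (\<forall>j. valid (Line j) ?T \<longrightarrow> line_gain ?T j < fst s' ''t''))"
      by (rule halts_conseq[OF halts_scan])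
        (use bin pos dims le_B time' s2 cells in \<open>auto simp: stored_def\<close>)
    have Q: "?Q s4"
      if imp2: "improves ?s3 ?T s4" and all2: "\<forall>j. valid (Line j) ?T \<longrightarrow> line_gain ?T j < fst s4 ''t''" for s4
    proof -
      have frame: "snd s4 = snd s \<and> (\<forall>y\<in>{''p'', ''q'', ''m'', ''n'', ''g''}. fst s4 y = fst s y)"
        using imp2 s2 rep' by (simp add: improves_def scan_registers_def)
      \<comment> \<open>The final \<open>t\<close> exceeds the gain of every valid contraction, of
        lines because \<open>t\<close> never decreases during the second scan. In particular
        \<open>t = 0\<close> means that none is valid.\<close>
      have less: "gain A x < fst s4 ''t''" if "valid x A" for x
      proof (cases x)
        case (Line i)
        have "fst s2 ''t'' \<le> fst s4 ''t''" using imp2 by (simp add: improves_def)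
        moreover have "gain A x < fst s2 ''t''" using all that Line by simp
        ultimately show ?thesis by simp
      next
        case (Column j)
        then show ?thesis using all2 that by (simp add: valid_Column_iff)
      qed
      \<comment> \<open>Either the column scan set the candidate, or it is inherited unchanged from
        the line scan; that one started with \<open>t = 0\<close>, so a nonzero value was set by
        it.\<close>
      have best: "valid (chosen s4) A \<and> fst s4 ''t'' = gain A (chosen s4) + 1" if "fst s4 ''t'' \<noteq> 0"
      proof (cases "valid (Line (fst s4 ''k'')) ?T \<and> fst s4 ''t'' = line_gain ?T (fst s4 ''k'') + 1 \<and> fst s4 ''d'' = 1")
        case True
        then show ?thesis by (simp add: chosen_def valid_Column_iff)
      next
        case False
        then have "fst s4 ''t'' = fst s2 ''t''" "fst s4 ''k'' = fst s2 ''k''" "fst s4 ''d'' = fst s2 ''d''"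
          using imp2 unfolding improves_def by auto
        moreover from this that imp have "valid (Line (fst s2 ''k'')) A \<and>
            fst s2 ''t'' = line_gain A (fst s2 ''k'') + 1 \<and> fst s2 ''d'' = 0"
          by (simp add: improves_def)
        ultimately show ?thesis by (simp add: chosen_def)
      qed
      show ?thesis
      proof (cases "fst s4 ''t'' = 0")
        case True
        with less frame show ?thesis by auto
      next
        case False
        then have "greedy_choice A (chosen s4)"
          using best less by (intro greedy_choiceI[OF bin]) (auto simp: less_Suc_eq_le)
        with False frame show ?thesis by simp
      qed
    qed
    have "halts B scan ?s3 (400 * (?p * ?q) + 20) ?Q"
      by (rule halts_conseq[OF scan2]) (use Q in blast, simp)
    then have "loop_free_wp B setup_columns (\<lambda>s'. halts B scan s' (400 * (?p * ?q) + 20) ?Q) s2"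
      using s2 dims le_B by (simp add: setup_columns_def safe_def)
    then show ?thesis
      by (rule halts_Seq[OF halts_loop_free[OF _ order_refl]]) (simp add: setup_columns_def)
  qed
  have "halts B (Seq scan (Seq setup_columns scan)) ?s1 (800 * (?p * ?q) + 61) ?Q"
    by (rule halts_Seq[OF halts_conseq[OF scan1 rest order_refl]]) simp_all
  then have "loop_free_wp B (Seq (Assign ''t'' (Num 0)) setup_lines)
      (\<lambda>s'. halts B (Seq scan (Seq setup_columns scan)) s' (800 * (?p * ?q) + 61) ?Q) s"
    using rep' dims le_B by (simp add: setup_lines_def safe_def)
  then show ?thesis unfolding select_def
    by (rule halts_Seq[OF halts_loop_free[OF _ order_refl]]) (simp add: setup_lines_def)
qed

text \<open>As n \<le> q, quotient and remainder by \<open>q\<close> recover line and column from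
  the address.\<close>

lemma separated_row_major:
  assumes "m \<le> p" "n \<le> q"
  shows "separated q 1 m n (p * q)"
  unfolding separated_def
proof (intro allI impI conjI)
  fix r c assume rc: "r < m" "c < n"
  have "r * q + c < (r + 1) * q" using rc assms by simp
  also have "\<dots> \<le> p * q" using rc assms by (intro mult_right_mono) auto
  finally show "r * q + c * 1 < p * q" by simp
  fix r' c' assume rc': "r' < m" "c' < n" and eq: "r * q + c * 1 = r' * q + c' * 1"
  have "c < q" "c' < q" using rc rc' assms by auto
  then have "(r * q + c) div q = r" "(r * q + c) mod q = c"
    "(r' * q + c') div q = r'" "(r' * q + c') mod q = c'" by simp_all
  then show "r = r'" "c = c'" using eq by simp_all
qed

lemma separated_swap: "separated u v m n sz \<Longrightarrow> separated v u n m sz"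
  unfolding separated_def by (metis add.commute)

text \<open>The position whose bit is set is the last input line of block \<open>k\<close>, which is
  what the rule \<open>greedy_reaches.line\<close> inserts; so the bits keep encoding
  \<open>L\<close>.\<close>

lemma halts_perform_line:
  assumes rep: "represents M A L C s" and B: "100 * (dim_row M * dim_col M) \<le> B"
    and d: "fst s ''d'' = 0" and choice: "greedy_choice A (Line (fst s ''k''))"
  shows "halts B perform s (150 * (dim_row M * dim_col M) + 120)
    (\<lambda>s'. (\<exists>A' L' C'. represents M A' L' C' s') \<and> fst s' ''g'' = fst s ''g'' \<and>
       fst s' ''m'' + fst s' ''n'' < fst s ''m'' + fst s ''n'')"
    (is "halts B perform s ?T ?Q")
proof -
  let ?p = "dim_row M" and ?q = "dim_col M" and ?k = "fst s ''k''"
  note rep' = rep[unfolded represents_def] and dims = represents_dims(3,4)[OF rep]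
  have bin: "binary A" and pos: "1 \<le> dim_row A" "1 \<le> dim_col A" using rep' by simp_all
  have pq: "?p \<le> ?p * ?q" "?q \<le> ?p * ?q" "1 \<le> ?p * ?q" using pos dims by auto
  then have le_B: "7 * ?p + 7 * ?q + ?p * ?q + 10 \<le> B" using B by linarith
  have time: "dim_row A * dim_col A \<le> ?p * ?q" using dims by (intro mult_mono) auto
  have val: "valid (Line ?k) A" using choice by (simp add: greedy_choice_def)
  then have k: "?k + 1 < dim_row A" by (simp add: valid_def)
  then obtain l where l: "l < ?p" "l \<notin> L" "current_index L l = ?k"
    using current_index_witness[of ?k L ?p] represents_dims(1)[OF rep] by auto
  let ?s1 = "((fst s)(''M'' := dim_row A, ''N'' := dim_col A, ''U'' := ?q, ''V'' := 1, ''D'' := 0,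
    ''b'' := ?p * ?q, ''m'' := dim_row A - 1), snd s)"
  let ?A = "contract (Line ?k) A"
  have contract: "halts B contract_line ?s1 (40 * ?p + 100 * (dim_row A * dim_col A) + 60)
    (\<lambda>s'. (\<forall>y. y \<notin> {''l'', ''j'', ''r'', ''c''} \<longrightarrow> fst s' y = fst ?s1 y) \<and>
       (\<forall>a\<ge>?p * ?q. snd s' a = ((snd ?s1)(fst ?s1 ''b'' + l := 1)) a) \<and>
       (\<forall>r<dim_row A - 1. \<forall>c<dim_col A. snd s' (r * fst ?s1 ''U'' + c * fst ?s1 ''V'') =
          contract (Line (fst ?s1 ''k'')) A $$ (r, c)))"
    (is "halts _ _ _ _ ?R")
    by (rule halts_contract_line[where L = L])
      (use rep' bin k l le_B dims pos separated_row_major[OF dims] in \<open>auto simp: stored_def\<close>)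
  have Q: "?Q s'" if "?R s'" for s'
  proof -
    have regs: "fst s' ''p'' = ?p" "fst s' ''q'' = ?q" "fst s' ''m'' = dim_row A - 1" "fst s' ''n'' = dim_col A"
      "fst s' ''g'' = fst s ''g''"
      using that rep' by simp_all
    have mem: "snd s' a = (if a = ?p * ?q + l then 1 else snd s a)" if "?p * ?q \<le> a" for a
      using \<open>?R s'\<close> that by simp
    have cells: "snd s' (r * ?q + c) = ?A $$ (r, c)" if "r < dim_row A - 1" "c < dim_col A" for r c
      using \<open>?R s'\<close> that by (simp del: contract.simps)
    have "greedy_reaches M ?A (insert l L) C"
      using greedy_reaches.line[of M A L C l] rep' l choice by simp
    moreover have "binary ?A" using val by (simp add: valid_def)
    ultimately have "represents M ?A (insert l L) C s'"
      unfolding represents_def using regs mem cells k rep' l by auto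
    then show ?thesis using regs rep' k by auto
  qed
  have "loop_free_wp B (Seq setup_lines (Seq (Assign ''b'' (Mul (Reg ''p'') (Reg ''q'')))
        (Assign ''m'' (Sub (Reg ''m'') (Num 1)))))
      (\<lambda>s'. halts B contract_line s' (40 * ?p + 100 * (dim_row A * dim_col A) + 60) ?Q) s"
    using rep' dims le_B halts_conseq[OF contract Q order_refl] by (simp add: setup_lines_def safe_def)
  then have "loop_free_wp B (If (Reg ''d'')
      (Seq setup_columns (Seq (Assign ''b'' (Add (Mul (Reg ''p'') (Reg ''q'')) (Reg ''p'')))
        (Assign ''n'' (Sub (Reg ''n'') (Num 1)))))
      (Seq setup_lines (Seq (Assign ''b'' (Mul (Reg ''p'') (Reg ''q'')))
        (Assign ''m'' (Sub (Reg ''m'') (Num 1))))))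
      (\<lambda>s'. halts B contract_line s' (40 * ?p + 100 * (dim_row A * dim_col A) + 60) ?Q) s"
    using d by (simp add: safe_def)
  then show ?thesis unfolding perform_def
    by (rule halts_Seq[OF halts_loop_free[OF _ order_refl]])
      (use time pq in \<open>unfold index_transpose_mat setup_columns_def setup_lines_def loop_free_steps.simps cost.simps, linarith\<close>)
qed

lemma halts_perform_column:
  assumes rep: "represents M A L C s" and B: "100 * (dim_row M * dim_col M) \<le> B"
    and d: "fst s ''d'' \<noteq> 0" and choice: "greedy_choice A (Column (fst s ''k''))"
  shows "halts B perform s (150 * (dim_row M * dim_col M) + 120)
    (\<lambda>s'. (\<exists>A' L' C'. represents M A' L' C' s') \<and> fst s' ''g'' = fst s ''g'' \<and>
       fst s' ''m'' + fst s' ''n'' < fst s ''m'' + fst s ''n'')"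
    (is "halts B perform s ?T ?Q")
proof -
  let ?p = "dim_row M" and ?q = "dim_col M" and ?k = "fst s ''k''"
  let ?X = "transpose_mat A"
  note rep' = rep[unfolded represents_def] and dims = represents_dims(3,4)[OF rep]
  have bin: "binary A" and pos: "1 \<le> dim_row A" "1 \<le> dim_col A" using rep' by simp_all
  have pq: "?p \<le> ?p * ?q" "?q \<le> ?p * ?q" "1 \<le> ?p * ?q" using pos dims by auto
  then have le_B: "7 * ?p + 7 * ?q + ?p * ?q + 10 \<le> B" using B by linarith
  have time: "dim_col A * dim_row A \<le> ?p * ?q"
    using mult_mono[OF dims(2,1)] by (simp add: mult.commute)
  have val: "valid (Column ?k) A" using choice by (simp add: greedy_choice_def)
  then have k: "?k + 1 < dim_col A" by (simp add: valid_def)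
  then obtain l where l: "l < ?q" "l \<notin> C" "current_index C l = ?k"
    using current_index_witness[of ?k C ?q] represents_dims(2)[OF rep] by auto
  let ?s1 = "((fst s)(''M'' := dim_col A, ''N'' := dim_row A, ''U'' := 1, ''V'' := ?q, ''D'' := 1,
    ''b'' := ?p * ?q + ?p, ''n'' := dim_col A - 1), snd s)"
  let ?A = "contract (Column ?k) A"
  have swapped: "snd s (r + c * ?q) = A $$ (c, r)" if "r < dim_col A" "c < dim_row A" for r c
    using rep' that by (metis add.commute)
  have contract: "halts B contract_line ?s1 (40 * ?q + 100 * (dim_row ?X * dim_col ?X) + 60)
    (\<lambda>s'. (\<forall>y. y \<notin> {''l'', ''j'', ''r'', ''c''} \<longrightarrow> fst s' y = fst ?s1 y) \<and>
       (\<forall>a\<ge>?p * ?q. snd s' a = ((snd ?s1)(fst ?s1 ''b'' + l := 1)) a) \<and>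
       (\<forall>r<dim_row ?X - 1. \<forall>c<dim_col ?X. snd s' (r * fst ?s1 ''U'' + c * fst ?s1 ''V'') =
          contract (Line (fst ?s1 ''k'')) ?X $$ (r, c)))"
    (is "halts _ _ _ _ ?R")
    by (rule halts_contract_line[where L = C])
      (use rep' swapped bin k l le_B dims pos separated_swap[OF separated_row_major[OF dims]]
        in \<open>auto simp: stored_def\<close>)
  have Q: "?Q s'" if "?R s'" for s'
  proof -
    have regs: "fst s' ''p'' = ?p" "fst s' ''q'' = ?q" "fst s' ''m'' = dim_row A" "fst s' ''n'' = dim_col A - 1"
      "fst s' ''g'' = fst s ''g''"
      using that rep' by simp_all
    have mem: "snd s' a = (if a = ?p * ?q + ?p + l then 1 else snd s a)" if "?p * ?q \<le> a" for a
      using \<open>?R s'\<close> that by simp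
    \<comment> \<open>With swapped strides, \<open>c + r * ?q\<close> addresses the same cell, and
      contracting a line of the transpose is contracting a column of \<open>A\<close>.\<close>
    have cells: "snd s' (r * ?q + c) = ?A $$ (r, c)" if "r < dim_row A" "c < dim_col A - 1" for r c
    proof -
      have "snd s' (c + r * ?q) = contract (Line ?k) ?X $$ (c, r)"
        using \<open>?R s'\<close> that by (simp del: contract.simps)
      also have "\<dots> = ?A $$ (r, c)"
        unfolding contract_Column_transpose by (rule index_transpose_mat(1)[symmetric]) (use that in simp_all)
      finally show ?thesis by (simp only: add.commute)
    qed
    have "greedy_reaches M ?A L (insert l C)"
      using greedy_reaches.column[of M A L C l] rep' l choice by simp
    moreover have "binary ?A" using val by (simp add: valid_def)
    ultimately have "represents M ?A L (insert l C) s'"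
      unfolding represents_def using regs mem cells k rep' l by auto
    then show ?thesis using regs rep' k by auto
  qed
  have "loop_free_wp B (Seq setup_columns (Seq (Assign ''b'' (Add (Mul (Reg ''p'') (Reg ''q'')) (Reg ''p'')))
        (Assign ''n'' (Sub (Reg ''n'') (Num 1)))))
      (\<lambda>s'. halts B contract_line s' (40 * ?q + 100 * (dim_row ?X * dim_col ?X) + 60) ?Q) s"
    using rep' dims le_B halts_conseq[OF contract Q order_refl] by (simp add: setup_columns_def safe_def)
  then have "loop_free_wp B (If (Reg ''d'')
      (Seq setup_columns (Seq (Assign ''b'' (Add (Mul (Reg ''p'') (Reg ''q'')) (Reg ''p'')))
        (Assign ''n'' (Sub (Reg ''n'') (Num 1)))))
      (Seq setup_lines (Seq (Assign ''b'' (Mul (Reg ''p'') (Reg ''q'')))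
        (Assign ''m'' (Sub (Reg ''m'') (Num 1))))))
      (\<lambda>s'. halts B contract_line s' (40 * ?q + 100 * (dim_row ?X * dim_col ?X) + 60) ?Q) s"
    using d by (simp add: safe_def)
  then show ?thesis unfolding perform_def
    by (rule halts_Seq[OF halts_loop_free[OF _ order_refl]])
      (use time pq in \<open>unfold index_transpose_mat setup_columns_def setup_lines_def loop_free_steps.simps cost.simps, linarith\<close>)
qed

text \<open>The measure m + n + g drops in both outcomes: a contraction removes a line or column and
  keeps g, while stopping clears g. The implication for \<open>g = 0\<close> carries the stopping
  condition to the exit of the main loop.\<close>

lemma halts_greedy_round:
  assumes rep: "represents M A L C s" and B: "100 * (dim_row M * dim_col M) \<le> B"
    and g: "fst s ''g'' \<noteq> 0"
  shows "halts B greedy_round s (1500 * (dim_row M * dim_col M))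
    (\<lambda>s'. (\<exists>A' L' C'. represents M A' L' C' s' \<and> (fst s' ''g'' = 0 \<longrightarrow> (\<nexists>x. valid x A'))) \<and>
       fst s' ''m'' + fst s' ''n'' + fst s' ''g'' < fst s ''m'' + fst s ''n'' + fst s ''g'')"
    (is "halts B greedy_round s ?T ?Q")
proof -
  let ?pq = "dim_row M * dim_col M"
  have pq: "1 \<le> ?pq" using rep represents_dims(3,4)[OF rep] by (auto simp: represents_def)
  have branch: "halts B (If (Reg ''t'') perform (Assign ''g'' (Num 0))) s1 (150 * ?pq + 130) ?Q"
    if s1: "snd s1 = snd s \<and> (\<forall>y\<in>{''p'', ''q'', ''m'', ''n'', ''g''}. fst s1 y = fst s y) \<and>
      (if fst s1 ''t'' = 0 then \<nexists>x. valid x A else greedy_choice A (chosen s1))" for s1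
  proof (rule halts_If[where k = "150 * ?pq + 120"])
    have rep1: "represents M A L C s1" using rep s1 by (simp add: represents_def)
    {
      assume "val (Reg ''t'') s1 \<noteq> 0"
      then have choice: "greedy_choice A (chosen s1)" using s1 by simp
      have "halts B perform s1 (150 * ?pq + 120) (\<lambda>s'. (\<exists>A' L' C'. represents M A' L' C' s') \<and>
          fst s' ''g'' = fst s1 ''g'' \<and> fst s' ''m'' + fst s' ''n'' < fst s1 ''m'' + fst s1 ''n'')"
      proof (cases "fst s1 ''d'' = 0")
        case True
        then show ?thesis
          using choice by (intro halts_perform_line[OF rep1 B]) (simp_all add: chosen_def)
      next
        case False
        then show ?thesis
          using choice by (intro halts_perform_column[OF rep1 B]) (simp_all add: chosen_def)
      qed
      then show "halts B perform s1 (150 * ?pq + 120) ?Q"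
        by (rule halts_conseq) (use s1 g in auto)
    }
    assume "val (Reg ''t'') s1 = 0"
    then have "\<nexists>x. valid x A" using s1 by simp
    moreover have "represents M A L C ((fst s1)(''g'' := 0), snd s1)"
      using rep1 by (simp add: represents_def)
    ultimately show "halts B (Assign ''g'' (Num 0)) s1 (150 * ?pq + 120) ?Q"
      using s1 g by (intro halts_loop_free) (auto simp: safe_def)
  qed (simp_all add: safe_def)
  show ?thesis unfolding greedy_round_def
    by (rule halts_Seq[OF halts_conseq[OF halts_select[OF rep B] branch order_refl]]) (use pq in linarith)+
qed

section \<open>Running time of the whole program\<close>

lemma represents_input:
  assumes "1 \<le> dim_row M" "1 \<le> dim_col M" "binary M"
  shows "represents M M {} {}
    ((fst (input_state M))(''m'' := dim_row M, ''n'' := dim_col M, ''g'' := 1), snd (input_state M))"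
proof -
  have "r * dim_col M + c < dim_row M * dim_col M" if "r < dim_row M" "c < dim_col M" for r c
    using separated_row_major[of "dim_row M" "dim_row M" "dim_col M" "dim_col M"] that
    by (simp add: separated_def)
  then show ?thesis using assms by (simp add: represents_def greedy_reaches.start input_state_def)
qed

lemma halts_greedy_program:
  assumes M: "1 \<le> dim_row M" "1 \<le> dim_col M" "binary M" and B: "100 * (dim_row M * dim_col M) \<le> B"
  shows "halts B greedy_program (input_state M) (5000 * ((dim_row M)\<^sup>2 * (dim_col M)\<^sup>2))
    (\<lambda>s'. \<exists>A L C. represents M A L C s' \<and> (\<nexists>x. valid x A))"
    (is "halts _ _ _ _ ?Q")
proof -
  let ?p = "dim_row M" and ?q = "dim_col M"
  let ?s = "((fst (input_state M))(''m'' := ?p, ''n'' := ?q, ''g'' := 1), snd (input_state M))"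
  have pq: "?p \<le> ?p * ?q" "?q \<le> ?p * ?q" "1 \<le> ?p * ?q" using M by auto
  have loop: "halts B (While (Reg ''g'') greedy_round) ?s (4510 * (?p * ?q * (?p * ?q))) ?Q"
  proof (rule halts_While[where k = "1500 * (?p * ?q)" and f = "\<lambda>s. fst s ''m'' + fst s ''n'' + fst s ''g''" and
        I = "\<lambda>s. \<exists>A L C. represents M A L C s \<and> (fst s ''g'' = 0 \<longrightarrow> (\<nexists>x. valid x A))"])
    \<comment> \<open>At most p + q + 1 \<le> 3pq rounds of at most 1502pq steps, test included,
      give 4506 times the square of pq. The constants 4510 and 5000 absorb the last test and the
      initialisation.\<close>
    have "?p + ?q + 1 \<le> 3 * (?p * ?q)" "1500 * (?p * ?q) + 2 \<le> 1502 * (?p * ?q)"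
      using pq by linarith+
    then have "(?p + ?q + 1) * (1500 * (?p * ?q) + 2) \<le> (3 * (?p * ?q)) * (1502 * (?p * ?q))"
      by (intro mult_mono) auto
    also have "\<dots> = 4506 * (?p * ?q * (?p * ?q))" by simp
    moreover have "1 \<le> ?p * ?q * (?p * ?q)" using mult_le_mono[OF pq(3,3)] by simp
    moreover have "fst ?s ''m'' + fst ?s ''n'' + fst ?s ''g'' = ?p + ?q + 1" by simp
    moreover have "1500 * (?p * ?q) + cost (Reg ''g'') + 1 = 1500 * (?p * ?q) + 2" by simp
    ultimately show "(fst ?s ''m'' + fst ?s ''n'' + fst ?s ''g'') * (1500 * (?p * ?q) + cost (Reg ''g'') + 1) +
        cost (Reg ''g'') + 1 \<le> 4510 * (?p * ?q * (?p * ?q))"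
      by (simp only: cost.simps)
  qed (use represents_input[OF M] halts_greedy_round[OF _ B] in \<open>auto simp: safe_def\<close>)
  have "loop_free_wp B (Seq (Assign ''m'' (Reg ''p'')) (Seq (Assign ''n'' (Reg ''q'')) (Assign ''g'' (Num 1))))
    (\<lambda>s'. halts B (While (Reg ''g'') greedy_round) s' (4510 * (?p * ?q * (?p * ?q))) ?Q) (input_state M)"
  proof -
    have "?p \<le> B" "?q \<le> B" "1 \<le> B" using pq B by linarith+
    then show ?thesis using loop by (simp add: safe_def input_state_def)
  qed
  then show ?thesis unfolding greedy_program_def
  proof (rule halts_Seq[OF halts_loop_free[OF _ order_refl]])
    have "1 \<le> ?p * ?q * (?p * ?q)" using mult_le_mono[OF pq(3,3)] by simp
    moreover have "?p\<^sup>2 * ?q\<^sup>2 = ?p * ?q * (?p * ?q)" by (simp add: power2_eq_square)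
    ultimately show "loop_free_steps (Seq (Assign ''m'' (Reg ''p'')) (Seq (Assign ''n'' (Reg ''q'')) (Assign ''g'' (Num 1)))) +
        4510 * (?p * ?q * (?p * ?q)) + 1 \<le> 5000 * (?p\<^sup>2 * ?q\<^sup>2)"
      by (simp only: loop_free_steps.simps cost.simps)
  qed
qed

theorem theorem4:
  shows "\<exists>(prog :: program) (k :: nat) (K :: nat). \<forall>(p :: nat) (q :: nat) (M :: nat mat).
    1 \<le> p \<longrightarrow> 1 \<le> q \<longrightarrow> M \<in> carrier_mat p q \<longrightarrow> binary M \<longrightarrow>
    (\<exists>t s. runs ((p * q + 1) ^ k) prog (input_state M) t s \<and>
           t \<le> K * (p\<^sup>2 * q\<^sup>2) \<and>
           greedy_returns M (output_lines p q s) (output_columns p q s))"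
proof (rule exI[of _ greedy_program], rule exI[of _ "8 * 200"], rule exI[of _ 5000], intro allI impI)
  fix p q :: nat and M :: "nat mat"
  assume pos: "1 \<le> p" "1 \<le> q" and carrier: "M \<in> carrier_mat p q" and bin: "binary M"
  have dims: "dim_row M = p" "dim_col M = q" using carrier by auto
  \<comment> \<open>The word size exponent \<open>8 * 200\<close> arises from this \<open>B\<close>
    and from the power \<open>B ^ 200\<close> that accommodates safe expressions.\<close>
  define B where "B = (p * q + 1) ^ 8"
  have pq: "p \<le> p * q" "q \<le> p * q" "1 \<le> p * q" using pos by auto
  \<comment> \<open>Since \<open>p * q + 1\<close> is at least 2, seven of the eight factors
    contribute at least 128, which covers the factor 100 demanded by
    \<open>halts_greedy_program\<close>.\<close>
  have "(2 :: nat) ^ 7 * (p * q + 1) \<le> (p * q + 1) ^ 7 * (p * q + 1)"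
    using pq by (intro mult_right_mono power_mono) auto
  also have "\<dots> = B" unfolding B_def by (metis power_Suc2 Suc_numeral semiring_norm(2,8))
  finally have B: "128 * (p * q) + 128 \<le> B" by simp
  have cell: "snd (input_state M) a \<le> 1" for a
  proof (cases "a < p * q")
    case True
    then have "a div q < p" "a mod q < q" using pos by (simp_all add: less_mult_imp_div_less)
    then show ?thesis using bin by (simp add: input_state_def dims binary_iff)
  qed (simp add: input_state_def dims)
  have le_B: "p \<le> B" "q \<le> B" "2 \<le> B" using B pq by linarith+
  have "snd (input_state M) a \<le> B" for a using cell[of a] le_B(3) by linarith
  with le_B have "bounded B (input_state M)" by (simp add: bounded_def input_state_def dims)
  with halts_greedy_program[of M B] obtain t s A L C where
    run: "runs (B ^ 200) greedy_program (input_state M) t s" "t \<le> 5000 * (p\<^sup>2 * q\<^sup>2)"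
    and rep: "represents M A L C s" and final: "\<nexists>x. valid x A"
    using pos bin B by (fastforce simp: dims elim!: haltsE)
  \<comment> \<open>The bits are 0 or 1 and both sets lie within the index ranges, so decoding
    recovers them exactly.\<close>
  have "output_lines p q s = L" "output_columns p q s = C"
    using rep by (auto simp: represents_def dims output_lines_def output_columns_def split: if_splits)
  then have "greedy_returns M (output_lines p q s) (output_columns p q s)"
    using rep final by (auto simp: greedy_returns_def represents_def)
  moreover have "B ^ 200 = (p * q + 1) ^ (8 * 200)" unfolding B_def by (rule power_mult[symmetric])
  ultimately show "\<exists>t s. runs ((p * q + 1) ^ (8 * 200)) greedy_program (input_state M) t s \<and>
      t \<le> 5000 * (p\<^sup>2 * q\<^sup>2) \<and> greedy_returns M (output_lines p q s) (output_columns p q s)"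
    using run by metis
qed

end
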